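(* Let $\Omega$ be the unit ball of $\mathbb{C}^{2}$ for the standard Hermitian norm, and for an integer $m\ge1$ and a real number $\mu>0$ let $$\widehat{\Omega}_{m}(\mu)=\{(z,Z)\in\Omega\times\mathbb{C}^{m}:\|Z\|^{2}<(1-\|z\|^{2})^{\mu}\}.$$ The domain $\widehat{\Omega}_{m}(\mu)$ is a Lu Qikeng domain - for $m=1$, if and only if $\mu\le2$; - for $m=2$, if and only if $\mu\le4$; - for $m\ge3$, for every $\mu>0$.
   Context: A domain $U\subset\mathbb{C}^n$ is called a Lu Qikeng domain if its Bergman kernel $K_U(z,w)$ has no zero on $U\times U$. $\|\cdot\|$ denotes the standard Hermitian norm. *)

theory Defs
  imports "HOL-Analysis.Analysis"
begin

text \<open>Complex \<open>n\<close>-space is \<^typ>\<open>complex ^ 'n\<close>; its library norm is the Hermitian norm and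
  \<^const>\<open>lborel\<close> is Lebesgue measure on the underlying real space of dimension \<open>2n\<close>.\<close>

definition holomorphic_several :: "(complex ^ 'n \<Rightarrow> complex) \<Rightarrow> (complex ^ 'n) set \<Rightarrow> bool" where
  "holomorphic_several f U \<longleftrightarrow>
     (\<forall>z\<in>U. \<exists>f'. (f has_derivative f') (at z) \<and> (\<forall>c v. f' (c *s v) = c * f' v))"

definition bergman_space :: "(complex ^ 'n) set \<Rightarrow> (complex ^ 'n \<Rightarrow> complex) set" where
  "bergman_space U =
     {f. holomorphic_several f U \<and> set_integrable lborel U (\<lambda>z. (cmod (f z))\<^sup>2)}"

text \<open>\<open>k\<close> represents evaluation at \<open>w\<close> for the \<open>L\<^sup>2\<close> inner product on the Bergman space.\<close>

definition reproduces_at ::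
    "(complex ^ 'n) set \<Rightarrow> complex ^ 'n \<Rightarrow> (complex ^ 'n \<Rightarrow> complex) \<Rightarrow> bool" where
  "reproduces_at U w k \<longleftrightarrow> k \<in> bergman_space U \<and>
     (\<forall>f\<in>bergman_space U. f w = set_lebesgue_integral lborel U (\<lambda>z. f z * cnj (k z)))"

text \<open>For open \<open>U\<close> and \<open>w \<in> U\<close> such a \<open>k\<close> exists by the Riesz representation theorem and is
  determined on \<open>U\<close>; the choice below is arbitrary only in the irrelevant values off \<open>U\<close>.\<close>

definition bergman_kernel ::
    "(complex ^ 'n) set \<Rightarrow> complex ^ 'n \<Rightarrow> complex ^ 'n \<Rightarrow> complex" where
  "bergman_kernel U z w = (SOME k. reproduces_at U w k) z"

definition lu_qikeng_domain :: "(complex ^ 'n) set \<Rightarrow> bool" where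
  "lu_qikeng_domain U \<longleftrightarrow> open U \<and> connected U \<and> U \<noteq> {} \<and>
     (\<forall>z\<in>U. \<forall>w\<in>U. bergman_kernel U z w \<noteq> 0)"

definition Omega :: "(complex ^ 2) set" where
  "Omega = ball 0 1"

text \<open>A point \<open>(z, Z)\<close> of the product of complex \<open>2\<close>-space and complex \<open>m\<close>-space is a vector
  indexed by the disjoint sum of the two index types, where \<open>m = CARD('m)\<close>.\<close>

definition base_part :: "complex ^ (2 + 'm::finite) \<Rightarrow> complex ^ 2" where
  "base_part v = (\<chi> i. v $ Inl i)"

definition fibre_part :: "complex ^ (2 + 'm::finite) \<Rightarrow> complex ^ 'm" where
  "fibre_part v = (\<chi> j. v $ Inr j)"

definition Omega_hat :: "real \<Rightarrow> (complex ^ (2 + 'm::finite)) set" where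
  "Omega_hat \<mu> = {v. base_part v \<in> Omega \<and>
     (norm (fibre_part v))\<^sup>2 < (1 - (norm (base_part v))\<^sup>2) powr \<mu>}"

end

theory Submission
  imports Defs "HOL-Complex_Analysis.Complex_Analysis" "HOL-Probability.Distributions"
begin

text \<open>
Why the theorem is true. Write \<open>m\<close> for the fibre dimension. The domain is invariant under
multiplying any coordinate by a unimodular number, so monomials are orthogonal in its Bergman space
and the Bergman kernel is the sum of the normalised products of monomials. Unitary maps of base and
fibre preserve the domain as well, so for a second point \<open>w\<close> one may assume that only one base
coordinate \<open>l\<close> and one fibre coordinate \<open>k\<close> of \<open>w\<close> are nonzero; then only the monomials
\<open>x\<^sup>a y\<^sup>b\<close> in the corresponding coordinates \<open>x\<close>, \<open>y\<close> of the first point contribute. Their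
squared norms are, up to a positive constant,
\<open>a! \<Gamma>(s + 1) / \<Gamma>(s + a + 3) * b! / (b + m)!\<close> with \<open>s = \<mu> (b + m)\<close>. The sum over \<open>a\<close> is a
binomial series, and what remains is
\<open>K = const * (1 - x l')\<^bsup>-(\<mu> m + 3)\<^esup> * (\<Sum>b. (b + m)!/b! (\<mu> (b + m) + 1) (\<mu> (b + m) + 2) \<xi>\<^sup>b)\<close>,
where \<open>\<xi> = y k' (1 - x l')\<^bsup>-\<mu>\<^esup>\<close> and primes denote conjugation. Expanding the quadratic factor in
\<open>1\<close>, \<open>b + m + 1\<close>, \<open>(b + m + 1) (b + m + 2)\<close> turns the last sum into
\<open>m! q(\<xi>) / (1 - \<xi>)\<^bsup>m + 3\<^esup>\<close> with a real quadratic polynomial \<open>q\<close>.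

On the domain \<open>\<xi>\<close> takes exactly the values of the open unit disc, so the domain is Lu Qikeng iff
\<open>q\<close> has no zero there. Since \<open>q(1) > 0\<close> and the constant coefficient of \<open>q\<close> exceeds the absolute
value of its leading coefficient, this holds iff \<open>q(-1) \<ge> 0\<close>; otherwise \<open>q\<close> changes sign on
\<open>(-1, 0)\<close>. Finally \<open>q(-1) = 8 + 6 (m - 1) \<mu> + m (m - 3) \<mu>\<^sup>2\<close>, which is \<open>2 (2 - \<mu>) (2 + \<mu>)\<close> for
\<open>m = 1\<close>, \<open>2 (4 - \<mu>) (1 + \<mu>)\<close> for \<open>m = 2\<close>, and positive for \<open>m \<ge> 3\<close>.

The proof that the explicit series is the kernel avoids power series in several variables.
Averaging over circle actions (\<open>circle_average\<close>) replaces a function of the Bergman space by one of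
its one-variable Taylor coefficients without changing its inner product with a monomial; three such
averages, one over all other coordinates, one over \<open>y\<close> and one over \<open>x\<close>, show that the inner product
with \<open>x\<^sup>a y\<^sup>b\<close> is a Taylor coefficient times the squared norm (\<open>monomial_coefficients\<close>). Summation
gives the reproducing property (\<open>explicit_kernel_reproduces\<close>), and two reproducing functions agree
because the reproducing property makes the kernel Hermitian (\<open>reproduces_at_symmetric\<close>).
\<close>

section \<open>Lebesgue measure under linear maps\<close>

lemma nn_integral_lborel_translation:
  fixes f :: "'a::euclidean_space \<Rightarrow> ennreal"
  assumes [measurable]: "f \<in> borel_measurable borel"
  shows "(\<integral>\<^sup>+x. f (c + x) \<partial>lborel) = (\<integral>\<^sup>+x. f x \<partial>lborel)"
proof -
  have "(\<integral>\<^sup>+x. f x \<partial>lborel) = (\<integral>\<^sup>+x. f x \<partial>distr lborel borel ((+) c))"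
    by (simp add: lborel_distr_plus)
  also have "\<dots> = (\<integral>\<^sup>+x. f (c + x) \<partial>lborel)"
    by (subst nn_integral_distr) auto
  finally show ?thesis ..
qed

text \<open>Uniqueness of Haar measure in the form needed here: the image of Lebesgue measure under \<open>T\<close> is
translation invariant because \<open>T\<close> is onto, and evaluating the integral of
\<open>indicator A (y + T x) * indicator B y\<close> in both orders shows that a translation-invariant measure
is proportional to Lebesgue measure. The test set \<open>B\<close> is a ball because it has to be symmetric
about the origin.\<close>

lemma distr_lborel_linear_mult:
  fixes T :: "'a::euclidean_space \<Rightarrow> 'b::euclidean_space"
  assumes lin: "linear T" and surj: "surj T" and A[measurable]: "A \<in> sets borel"
  shows "emeasure (distr lborel borel T) A * emeasure lborel (ball (0::'b) 1)
       = emeasure lborel A * emeasure lborel (T -` ball 0 1)"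
proof -
  have [measurable]: "T \<in> borel_measurable borel"
    using lin by (intro borel_measurable_continuous_onI linear_continuous_on) (simp add: linear_conv_bounded_linear)
  \<comment> \<open>the two translations below replace \<open>T x\<close> by \<open>y + T x\<close> under the integral over \<open>x\<close>, and \<open>y + T x\<close> by \<open>y\<close> under the integral over \<open>y\<close>\<close>
  define B where "B = ball (0::'b) 1"
  have B[measurable]: "B \<in> sets borel" by (simp add: B_def)
  have TB: "T -` B \<in> sets borel" using measurable_sets[of T borel borel B] by simp
  have tr: "(\<integral>\<^sup>+x. g (T x) \<partial>lborel) = (\<integral>\<^sup>+x. g (y + T x) \<partial>lborel)"
    if [measurable]: "g \<in> borel_measurable borel" for g :: "'b \<Rightarrow> ennreal" and y
  proof -
    obtain u where u: "T u = y" using surj by (metis surjD)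
    show ?thesis
      using nn_integral_lborel_translation[of "\<lambda>x. g (T x)" u]
      by (simp add: linear_add[OF lin] u)
  qed
  have "emeasure (distr lborel borel T) A * emeasure lborel B
      = (\<integral>\<^sup>+x. indicator A (T x) \<partial>lborel) * (\<integral>\<^sup>+y. indicator B y \<partial>lborel)"
    by (simp add: nn_integral_indicator[symmetric] nn_integral_distr del: nn_integral_indicator)
  also have "\<dots> = (\<integral>\<^sup>+y. (\<integral>\<^sup>+x. indicator A (T x) \<partial>lborel) * indicator B y \<partial>lborel)"
    by (subst nn_integral_cmult) auto
  also have "\<dots> = (\<integral>\<^sup>+y. (\<integral>\<^sup>+x. indicator A (y + T x) * indicator B y \<partial>lborel) \<partial>lborel)"
    by (intro nn_integral_cong, subst tr, measurable, subst nn_integral_multc, auto)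
  also have "\<dots> = (\<integral>\<^sup>+x. (\<integral>\<^sup>+y. indicator A (y + T x) * indicator B y \<partial>lborel) \<partial>lborel)"
    by (rule lborel_pair.Fubini') measurable
  also have "\<dots> = (\<integral>\<^sup>+x. (\<integral>\<^sup>+y. indicator A y * indicator B (y - T x) \<partial>lborel) \<partial>lborel)"
  proof (rule nn_integral_cong)
    fix x :: 'a
    show "(\<integral>\<^sup>+y. (indicator A (y + T x) * indicator B y :: ennreal) \<partial>lborel) = (\<integral>\<^sup>+y. indicator A y * indicator B (y - T x) \<partial>lborel)"
      using nn_integral_lborel_translation[of "\<lambda>y. indicator A y * indicator B (y - T x) :: ennreal" "T x"]
      by (simp add: add.commute)
  qed
  also have "\<dots> = (\<integral>\<^sup>+y. (\<integral>\<^sup>+x. indicator A y * indicator B (y - T x) \<partial>lborel) \<partial>lborel)"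
    by (rule lborel_pair.Fubini') measurable
  also have "\<dots> = (\<integral>\<^sup>+y. indicator A y * emeasure lborel (T -` B) \<partial>lborel)"
  proof (intro nn_integral_cong)
    fix y
    have "(\<integral>\<^sup>+x. indicator B (y - T x) \<partial>lborel) = (\<integral>\<^sup>+x. indicator B (- T x) \<partial>lborel :: ennreal)"
      using tr[of "\<lambda>v. indicator B (- v)" "-y"] by simp
    also have "\<dots> = (\<integral>\<^sup>+x. indicator (T -` B) x \<partial>lborel)"
      by (intro nn_integral_cong) (auto simp: B_def indicator_def)
    also have "\<dots> = emeasure lborel (T -` B)" using TB by simp
    finally show "(\<integral>\<^sup>+x. indicator A y * indicator B (y - T x) \<partial>lborel) = indicator A y * emeasure lborel (T -` B)"
      by (subst nn_integral_cmult) auto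
  qed
  also have "\<dots> = emeasure lborel A * emeasure lborel (T -` B)"
    by (subst nn_integral_multc) auto
  finally show ?thesis by (simp add: B_def)
qed

lemma emeasure_unit_ball_pos_finite:
  "0 < emeasure lborel (ball (0::'b::euclidean_space) 1)" "emeasure lborel (ball (0::'b) 1) < \<infinity>"
  by (auto simp: emeasure_lborel_ball_finite emeasure_ball)

lemma distr_lborel_linear_bij:
  fixes T :: "'a::euclidean_space \<Rightarrow> 'b::euclidean_space"
  assumes lin: "linear T" and bij: "bij T"
  obtains c :: real where "c > 0" "distr lborel borel T = density lborel (\<lambda>_. ennreal c)"
proof -
  have [measurable]: "T \<in> borel_measurable borel"
    using lin by (intro borel_measurable_continuous_onI linear_continuous_on) (simp add: linear_conv_bounded_linear)
  have op: "open (T -` ball 0 1)"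
    using lin by (intro open_vimage linear_continuous_on) (auto simp: linear_conv_bounded_linear)
  have ne: "0 \<in> T -` ball 0 1" using linear_0[OF lin] by simp
  have linv: "linear (inv T)" using lin bij by (metis bij_is_inj bij_is_surj inv_o_cancel linear_injective_left_inverse left_right_inverse_eq surj_iff)
  have eq: "T -` ball 0 1 = inv T ` ball 0 1"
    using bij by (simp add: bij_vimage_eq_inv_image)
  have bd: "bounded (T -` ball 0 1)"
    unfolding eq using linv by (intro bounded_linear_image) (auto simp: linear_conv_bounded_linear)
  let ?b = "emeasure lborel (ball (0::'b) 1)" and ?a = "emeasure lborel (T -` ball 0 1)"
  have fa: "?a < \<infinity>" using emeasure_bounded_finite[OF bd] by simp
  have pa: "?a \<noteq> 0"
  proof -
    obtain r where r: "r > 0" "ball 0 r \<subseteq> T -` ball 0 1" using op ne openE by blast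
    have "emeasure lborel (ball (0::'a) r) > 0" using r unit_ball_vol_pos[of "real DIM('a)"]
      by (simp add: emeasure_ball)
    also have "emeasure lborel (ball (0::'a) r) \<le> ?a" using op r by (intro emeasure_mono) auto
    finally show ?thesis by auto
  qed
  note b = emeasure_unit_ball_pos_finite[where 'b='b]
  obtain a' where a': "?a = ennreal a'" "a' > 0" using fa pa
    by (cases ?a) (auto simp: less_le)
  obtain b' where b': "?b = ennreal b'" "b' > 0" using b
    by (cases ?b) (auto simp: less_le)
  show ?thesis
  proof
    show "a' / b' > 0" using a' b' by simp
    show "distr lborel borel T = density lborel (\<lambda>_. ennreal (a' / b'))"
    proof (rule measure_eqI)
      fix A assume "A \<in> sets (distr lborel borel T)"
      hence A[measurable]: "A \<in> sets borel" by simp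
      from distr_lborel_linear_mult[OF lin bij_is_surj[OF bij] A]
      have e: "emeasure (distr lborel borel T) A * ennreal b' = emeasure lborel A * ennreal a'"
        by (simp add: a' b')
      have "emeasure (distr lborel borel T) A = emeasure (distr lborel borel T) A * ennreal b' * ennreal (1 / b')"
        using b' by (simp add: mult.assoc ennreal_mult'[symmetric] del: emeasure_distr)
      also have "\<dots> = emeasure lborel A * ennreal (a' / b')"
        unfolding e using a' b' by (simp add: mult.assoc ennreal_mult'[symmetric])
      finally show "emeasure (distr lborel borel T) A = emeasure (density lborel (\<lambda>_. ennreal (a' / b'))) A"
        by (simp add: emeasure_density_const mult.commute del: emeasure_distr)
    qed simp
  qed
qed

lemma distr_lborel_isometry:
  fixes T :: "'a::euclidean_space \<Rightarrow> 'a"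
  assumes lin: "linear T" and iso: "\<And>x. norm (T x) = norm x"
  shows "distr lborel borel T = lborel"
proof (rule measure_eqI)
  fix A assume "A \<in> sets (distr lborel borel T)"
  hence A[measurable]: "A \<in> sets borel" by simp
  have inj: "inj T"
    using lin iso by (metis linear_injective_0 norm_eq_zero)
  have surj: "surj T" using lin inj by (simp add: linear_inj_imp_surj)
  have "T -` ball 0 1 = ball 0 1" by (auto simp: iso)
  with distr_lborel_linear_mult[OF lin surj A]
  have "emeasure (distr lborel borel T) A * emeasure lborel (ball (0::'a) 1)
       = emeasure lborel A * emeasure lborel (ball (0::'a) 1)" by (simp del: emeasure_distr)
  thus "emeasure (distr lborel borel T) A = emeasure lborel A"
    using emeasure_unit_ball_pos_finite[where 'b='a] by (auto simp: ennreal_mult_cancel_left mult.commute[of _ "emeasure lborel (ball (0::'a) 1)"] simp del: emeasure_distr)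
qed simp

section \<open>Moments of a coordinate over Euclidean balls\<close>

text \<open>The index \<open>b\<close> is half of the exponent and \<open>R\<close> is the squared radius, so that both match the
defining inequality of the domain.\<close>

definition ball_moment :: "'n::finite \<Rightarrow> nat \<Rightarrow> real \<Rightarrow> ennreal" where
  "ball_moment j b R = (\<integral>\<^sup>+Z. ennreal (cmod (Z $ j) ^ (2 * b)) * indicator {Z. (norm Z)\<^sup>2 < R} Z
      \<partial>(lborel :: (complex ^ 'n) measure))"

lemma borel_measurable_complex_vec_nth [measurable]:
  "(\<lambda>Z :: complex ^ 'n::finite. Z $ j) \<in> borel_measurable borel"
  by (intro borel_measurable_continuous_onI continuous_intros)

lemma ball_moment_scale:
  assumes "R > 0"
  shows "ball_moment (j :: 'n::finite) b R = ennreal (R ^ (b + CARD('n))) * ball_moment j b 1"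
proof -
  define c where "c = sqrt R"
  have c: "c > 0" "c\<^sup>2 = R" using assms by (auto simp: c_def)
  let ?f = "\<lambda>Z::complex ^ 'n. ennreal (cmod (Z $ j) ^ (2 * b)) * indicator {Z. (norm Z)\<^sup>2 < R} Z"
  have fm: "?f \<in> borel_measurable borel" by measurable
  have "ball_moment j b R = integral\<^sup>N (density (distr lborel borel (\<lambda>Z. 0 + c *\<^sub>R Z)) (\<lambda>_. ennreal (\<bar>c\<bar> ^ DIM(complex ^ 'n)))) ?f"
    unfolding ball_moment_def using lborel_affine[of c "0 :: complex ^ 'n"] c by simp
  also have "\<dots> = ennreal (\<bar>c\<bar> ^ DIM(complex ^ 'n)) * (\<integral>\<^sup>+Z. ?f (c *\<^sub>R Z) \<partial>lborel)"
    using fm by (simp add: nn_integral_density nn_integral_cmult nn_integral_distr)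
  also have "\<bar>c\<bar> ^ DIM(complex ^ 'n) = c ^ (2 * CARD('n))"
    using c by (simp add: mult.commute)
  also have "\<dots> = R ^ CARD('n)" unfolding power_mult c(2) ..
  also have "(\<integral>\<^sup>+Z. ?f (c *\<^sub>R Z) \<partial>lborel) = (\<integral>\<^sup>+Z. ennreal (R ^ b) * (ennreal (cmod (Z $ j) ^ (2 * b)) * indicator {Z. (norm Z)\<^sup>2 < 1} Z) \<partial>lborel)"
  proof (rule nn_integral_cong)
    fix Z :: "complex ^ 'n"
    have "(norm (c *\<^sub>R Z))\<^sup>2 < R \<longleftrightarrow> (norm Z)\<^sup>2 < 1"
      using c assms by (simp add: power_mult_distrib)
    moreover have "cmod ((c *\<^sub>R Z) $ j) ^ (2 * b) = R ^ b * cmod (Z $ j) ^ (2 * b)"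
      using c by (simp add: power_mult_distrib norm_mult flip: power_mult)
                 (simp add: power_mult)
    ultimately show "?f (c *\<^sub>R Z) = ennreal (R ^ b) * (ennreal (cmod (Z $ j) ^ (2 * b)) * indicator {Z. (norm Z)\<^sup>2 < 1} Z)"
      using assms by (simp add: ennreal_mult' mult.assoc indicator_def)
  qed
  also have "\<dots> = ennreal (R ^ b) * ball_moment j b 1"
    unfolding ball_moment_def by (rule nn_integral_cmult) measurable
  finally show ?thesis using assms by (simp add: power_add ennreal_mult' mult_ac)
qed

lemma ball_moment_nonpos: "R \<le> 0 \<Longrightarrow> ball_moment (j :: 'n::finite) b R = 0"
proof -
  assume "R \<le> 0"
  hence "{Z :: complex ^ 'n. (norm Z)\<^sup>2 < R} = {}"
    by (auto simp: not_less intro: order_trans[OF _ zero_le_power2])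
  thus ?thesis unfolding ball_moment_def by simp
qed

lemma ball_moment_1_finite: "ball_moment (j :: 'n::finite) b 1 < \<infinity>"
proof -
  have "ball_moment j b 1 \<le> (\<integral>\<^sup>+Z. indicator (ball 0 1) Z \<partial>(lborel :: (complex ^ 'n) measure))"
    unfolding ball_moment_def
  proof (rule nn_integral_mono)
    fix Z :: "complex ^ 'n"
    show "ennreal (cmod (Z $ j) ^ (2 * b)) * indicator {Z. (norm Z)\<^sup>2 < 1} Z \<le> indicator (ball 0 1) Z"
    proof (cases "norm Z < 1")
      case True
      have "cmod (Z $ j) \<le> 1" using True Finite_Cartesian_Product.norm_nth_le[of Z j] by simp
      hence "cmod (Z $ j) ^ (2 * b) \<le> 1" by (simp add: power_le_one)
      thus ?thesis using True by (simp add: indicator_def ennreal_le_1)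
    next
      case False
      thus ?thesis by (simp add: indicator_def abs_square_less_1)
    qed
  qed
  also have "\<dots> < \<infinity>" using emeasure_unit_ball_pos_finite(2) by simp
  finally show ?thesis .
qed

lemma nn_integral_exp_tail: "(\<integral>\<^sup>+t. ennreal (exp (- t)) * indicator {r<..} t \<partial>lborel) = ennreal (exp (- r))"
proof -
  have "(\<integral>\<^sup>+t. ennreal (exp (- t)) * indicator {r<..} t \<partial>lborel) = (\<integral>\<^sup>+t. ennreal (exp (- t)) * indicator {r..} t \<partial>lborel)"
    using AE_lborel_singleton[of r] by (intro nn_integral_cong_AE, eventually_elim) (auto simp: indicator_def)
  also have "\<dots> = (\<integral>\<^sup>+t. ennreal (exp (- (r + t))) * indicator {r..} (r + t) \<partial>lborel)"
    by (rule nn_integral_lborel_translation[symmetric]) measurable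
  also have "\<dots> = (\<integral>\<^sup>+t. ennreal (exp (- r)) * (ennreal (t ^ 0 * exp (- t)) * indicator {0..} t) \<partial>lborel)"
    by (intro nn_integral_cong) (auto simp: indicator_def exp_diff exp_minus ennreal_mult'[symmetric] field_simps)
  also have "\<dots> = ennreal (exp (- r))"
    by (subst nn_integral_cmult, measurable, subst nn_intergal_power_times_exp_Ici) simp
  finally show ?thesis .
qed

definition gauss_moment :: "'n::finite \<Rightarrow> nat \<Rightarrow> ennreal" where
  "gauss_moment j b = (\<integral>\<^sup>+Z. ennreal (cmod (Z $ j) ^ (2 * b)) * ennreal (exp (- (norm Z)\<^sup>2))
      \<partial>(lborel :: (complex ^ 'n) measure))"

text \<open>Writing the Gaussian weight as the integral of \<open>exp (- t)\<close> over \<open>t > \<parallel>Z\<parallel>\<^sup>2\<close> reduces it to balls of all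
radii, which scale.\<close>

lemma gauss_moment_eq_ball_moment:
  "gauss_moment (j :: 'n::finite) b = ennreal (fact (b + CARD('n))) * ball_moment j b 1"
proof -
  let ?p = "\<lambda>Z::complex ^ 'n. ennreal (cmod (Z $ j) ^ (2 * b))"
  have "gauss_moment j b = (\<integral>\<^sup>+Z. (\<integral>\<^sup>+t. ?p Z * (ennreal (exp (- t)) * indicator {(norm Z)\<^sup>2<..} t) \<partial>lborel) \<partial>lborel)"
    unfolding gauss_moment_def
    by (intro nn_integral_cong, subst nn_integral_cmult, measurable) (simp add: nn_integral_exp_tail)
  also have "\<dots> = (\<integral>\<^sup>+Z. (\<integral>\<^sup>+t. ennreal (exp (- t)) * (?p Z * indicator {x. (norm (fst x))\<^sup>2 < snd x} (Z, t)) \<partial>lborel) \<partial>lborel)"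
    by (intro nn_integral_cong) (auto simp: indicator_def mult.commute)
  also have "\<dots> = (\<integral>\<^sup>+t. (\<integral>\<^sup>+Z. ennreal (exp (- t)) * (?p Z * indicator {x. (norm (fst x))\<^sup>2 < snd x} (Z, t)) \<partial>lborel) \<partial>lborel)"
    by (rule lborel_pair.Fubini'[symmetric]) measurable
  also have "\<dots> = (\<integral>\<^sup>+t. ennreal (exp (- t)) * ball_moment j b t \<partial>lborel)"
  proof (rule nn_integral_cong)
    fix t :: real
    have "(\<integral>\<^sup>+Z. ennreal (exp (- t)) * (?p Z * indicator {x. (norm (fst x))\<^sup>2 < snd x} (Z, t)) \<partial>lborel)
      = ennreal (exp (- t)) * (\<integral>\<^sup>+Z. ?p Z * indicator {x. (norm (fst x))\<^sup>2 < snd x} (Z, t) \<partial>lborel)"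
      by (rule nn_integral_cmult) measurable
    thus "(\<integral>\<^sup>+Z. ennreal (exp (- t)) * (?p Z * indicator {x. (norm (fst x))\<^sup>2 < snd x} (Z, t)) \<partial>lborel)
       = ennreal (exp (- t)) * ball_moment j b t"
      by (simp add: ball_moment_def indicator_def)
  qed
  also have "\<dots> = (\<integral>\<^sup>+t. (ennreal (t ^ (b + CARD('n)) * exp (- t)) * indicator {0..} t) * ball_moment j b 1 \<partial>lborel)"
  proof (rule nn_integral_cong)
    fix t :: real
    show "ennreal (exp (- t)) * ball_moment j b t = (ennreal (t ^ (b + CARD('n)) * exp (- t)) * indicator {0..} t) * ball_moment j b 1"
    proof (cases "t > 0")
      case True
      thus ?thesis by (simp add: ball_moment_scale[OF True] ennreal_mult' mult_ac)
    next
      case False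
      thus ?thesis by (cases "t = 0") (auto simp: ball_moment_nonpos)
    qed
  qed
  also have "\<dots> = ennreal (fact (b + CARD('n))) * ball_moment j b 1"
    by (subst nn_integral_multc, measurable, subst nn_intergal_power_times_exp_Ici) simp
  finally show ?thesis .
qed

lemma nn_integral_coordinate_scale:
  fixes j :: "'n::finite" and f :: "complex ^ 'n \<Rightarrow> ennreal"
  assumes c: "c > 0" and f[measurable]: "f \<in> borel_measurable borel"
  shows "(\<integral>\<^sup>+Z. f Z \<partial>lborel) = ennreal (c\<^sup>2) * (\<integral>\<^sup>+Z. f (\<chi> i. if i = j then of_real c * Z $ i else Z $ i) \<partial>lborel)"
proof -
  define cc :: "complex ^ 'n \<Rightarrow> real" where "cc b = (if b = axis j 1 \<or> b = axis j \<i> then c else 1)" for b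
  define T :: "complex ^ 'n \<Rightarrow> complex ^ 'n" where "T x = 0 + (\<Sum>b\<in>Basis. (cc b * (x \<bullet> b)) *\<^sub>R b)" for x
  have T: "T x = (\<chi> i. if i = j then of_real c * x $ i else x $ i)" for x
  proof (rule euclidean_eqI)
    fix b :: "complex ^ 'n" assume b: "b \<in> Basis"
    then obtain i u where iu: "b = axis i u" "u = 1 \<or> u = \<i>"
      by (auto simp: Basis_vec_def Basis_complex_def)
    have "T x \<bullet> b = cc b * (x \<bullet> b)"
      using b by (simp add: T_def inner_sum_left inner_Basis if_distrib cong: if_cong)
    also have "\<dots> = (\<chi> i. if i = j then of_real c * x $ i else x $ i) \<bullet> b"
      using iu by (auto simp: cc_def inner_axis axis_eq_axis inner_complex_def)
    finally show "T x \<bullet> b = (\<chi> i. if i = j then of_real c * x $ i else x $ i) \<bullet> b" .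
  qed
  have "(\<Prod>b\<in>Basis. \<bar>cc b\<bar>) = (\<Prod>b\<in>{axis j 1, axis j \<i>}. c)"
    using c by (intro prod.mono_neutral_cong_right) (auto simp: cc_def Basis_vec_def Basis_complex_def)
  also have "\<dots> = c\<^sup>2"
    by (subst prod_constant) (auto simp: axis_eq_axis complex_eq_iff power2_eq_square)
  finally have P: "(\<Prod>b\<in>Basis. \<bar>cc b\<bar>) = c\<^sup>2" .
  have [measurable]: "T \<in> borel_measurable borel" unfolding T_def by measurable
  have "(\<integral>\<^sup>+Z. f Z \<partial>lborel) = (\<integral>\<^sup>+Z. f Z \<partial>density (distr lborel borel T) (\<lambda>_. (\<Prod>b\<in>Basis. \<bar>cc b\<bar>)))"
    unfolding T_def by (subst lborel_affine_euclidean[of cc 0, symmetric]) (use c in \<open>auto simp: cc_def\<close>)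
  also have "\<dots> = ennreal (c\<^sup>2) * (\<integral>\<^sup>+Z. f (T Z) \<partial>lborel)"
    unfolding P by (simp add: nn_integral_density nn_integral_cmult nn_integral_distr)
  finally show ?thesis by (simp add: T)
qed

lemma gauss_moment_0_pos: "gauss_moment j 0 > 0"
proof -
  have "ball_moment j 0 1 = emeasure lborel (ball (0::complex ^ 'a) 1)"
    by (simp add: ball_moment_def abs_square_less_1) (simp add: ball_def)
  thus ?thesis using emeasure_unit_ball_pos_finite[where 'b="complex ^ 'a"]
    by (simp add: gauss_moment_eq_ball_moment ennreal_zero_less_mult_iff)
qed

text \<open>The generating function of the Gaussian moments is itself a Gaussian integral: stretching the single
coordinate \<open>j\<close> by \<open>1 / sqrt (1 - x)\<close> absorbs the factor \<open>exp (x \<bar>Z\<^sub>j\<bar>\<^sup>2)\<close>. This replaces polar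
coordinates.\<close>

lemma gauss_moment_generating:
  assumes x: "0 \<le> x" "x < 1"
  shows "(\<Sum>b. ennreal (x ^ b / fact b) * gauss_moment j b) = ennreal (1 / (1 - x)) * gauss_moment (j :: 'n::finite) 0"
proof -
  let ?c = "1 / sqrt (1 - x)"
  let ?T = "\<lambda>Z :: complex ^ 'n. \<chi> i. if i = j then of_real ?c * Z $ i else Z $ i"
  have "(\<Sum>b. ennreal (x ^ b / fact b) * gauss_moment j b)
      = (\<Sum>b. \<integral>\<^sup>+Z. ennreal (x ^ b / fact b) * (ennreal (cmod (Z $ j) ^ (2 * b)) * ennreal (exp (- (norm Z)\<^sup>2))) \<partial>(lborel :: (complex ^ 'n) measure))"
    unfolding gauss_moment_def by (subst nn_integral_cmult) auto
  also have "\<dots> = (\<integral>\<^sup>+Z. (\<Sum>b. ennreal (x ^ b / fact b) * (ennreal (cmod (Z $ j) ^ (2 * b)) * ennreal (exp (- (norm Z)\<^sup>2)))) \<partial>(lborel :: (complex ^ 'n) measure))"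
    by (rule nn_integral_suminf[symmetric]) measurable
  also have "\<dots> = (\<integral>\<^sup>+Z. ennreal (exp (x * (cmod (Z $ j))\<^sup>2 - (norm Z)\<^sup>2)) \<partial>(lborel :: (complex ^ 'n) measure))"
  proof (rule nn_integral_cong)
    fix Z :: "complex ^ 'n"
    let ?y = "x * (cmod (Z $ j))\<^sup>2"
    have s: "(\<lambda>b. (?y ^ b /\<^sub>R fact b) * exp (- (norm Z)\<^sup>2)) sums (exp ?y * exp (- (norm Z)\<^sup>2))"
      by (intro sums_mult2 exp_converges)
    have "(\<Sum>b. ennreal (x ^ b / fact b) * (ennreal (cmod (Z $ j) ^ (2 * b)) * ennreal (exp (- (norm Z)\<^sup>2))))
        = (\<Sum>b. ennreal ((?y ^ b /\<^sub>R fact b) * exp (- (norm Z)\<^sup>2)))"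
      using x unfolding power_mult power_mult_distrib
      by (intro suminf_cong) (simp add: ennreal_mult'[symmetric] field_simps)
    also have "\<dots> = ennreal (exp ?y * exp (- (norm Z)\<^sup>2))"
      using x by (subst suminf_ennreal2) (use s in \<open>auto simp: sums_iff\<close>)
    finally show "(\<Sum>b. ennreal (x ^ b / fact b) * (ennreal (cmod (Z $ j) ^ (2 * b)) * ennreal (exp (- (norm Z)\<^sup>2))))
       = ennreal (exp (?y - (norm Z)\<^sup>2))" by (simp add: exp_diff exp_minus field_simps)
  qed
  also have "\<dots> = ennreal (?c\<^sup>2) * (\<integral>\<^sup>+Z. ennreal (exp (x * (cmod (?T Z $ j))\<^sup>2 - (norm (?T Z))\<^sup>2)) \<partial>lborel)"
    by (rule nn_integral_coordinate_scale) (use x in auto)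
  also have "(\<lambda>Z. x * (cmod (?T Z $ j))\<^sup>2 - (norm (?T Z))\<^sup>2) = (\<lambda>Z. - (norm Z)\<^sup>2)"
  proof
    fix Z :: "complex ^ 'n"
    have "(norm V)\<^sup>2 = (cmod (V $ j))\<^sup>2 + (\<Sum>i\<in>UNIV - {j}. (cmod (V $ i))\<^sup>2)" for V :: "complex ^ 'n"
      by (simp add: norm_vec_def L2_set_def sum_nonneg sum.remove[of UNIV j])
    from this[of "?T Z"] this[of Z]
    have "x * (cmod (?T Z $ j))\<^sup>2 - (norm (?T Z))\<^sup>2 = (x - 1) * ?c\<^sup>2 * (cmod (Z $ j))\<^sup>2 + (cmod (Z $ j))\<^sup>2 - (norm Z)\<^sup>2"
      using x by (simp add: norm_mult norm_divide power_mult_distrib power_divide algebra_simps diff_divide_distrib)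
    also have "(x - 1) * ?c\<^sup>2 = -1" using x by (simp add: power_divide field_simps)
    finally show "x * (cmod (?T Z $ j))\<^sup>2 - (norm (?T Z))\<^sup>2 = - (norm Z)\<^sup>2" by simp
  qed
  also have "(1 / sqrt (1 - x))\<^sup>2 = 1 / (1 - x)" using x by (simp add: power_divide)
  finally show ?thesis by (simp add: gauss_moment_def)
qed

lemma gauss_moment_finite: "gauss_moment j b < \<infinity>"
  using ball_moment_1_finite[of j b] by (simp add: gauss_moment_eq_ball_moment ennreal_mult_less_top)

text \<open>Comparison of coefficients with the geometric series.\<close>

lemma gauss_moment_eq: "gauss_moment j b = ennreal (fact b) * gauss_moment j 0"
proof -
  define g where "g b = enn2real (gauss_moment j b)" for b
  have g: "gauss_moment j b = ennreal (g b)" "g b \<ge> 0" for b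
    using gauss_moment_finite[of j b] by (auto simp: g_def)
  \<comment> \<open>the power series with these coefficients vanishes on \<open>[0, 1)\<close>, hence so do the coefficients\<close>
  define a where "a b = g b / fact b - g 0" for b
  have sm0: "(\<lambda>b. g b / fact b * x ^ b) sums (g 0 / (1 - x))" if x: "0 \<le> x" "x < 1" for x
  proof -
    have e: "(\<Sum>b. ennreal (g b / fact b * x ^ b)) = ennreal (g 0 / (1 - x))"
      using gauss_moment_generating[OF x, of j] x g(2)
      by (simp add: g(1) ennreal_mult'[symmetric] mult.commute)
    have nn: "g b / fact b * x ^ b \<ge> 0" for b using g(2) x by simp
    have "summable (\<lambda>b. g b / fact b * x ^ b)"
      by (rule summable_suminf_not_top) (use nn e in auto)
    with e show ?thesis using g(2)[of 0] x nn
      by (subst (asm) suminf_ennreal2) (auto simp: sums_iff suminf_nonneg)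
  qed
  have sm: "summable (\<lambda>b. a b * x ^ b)" if x: "norm x < 1" for x :: real
  proof -
    have "summable (\<lambda>b. norm (g b / fact b * x ^ b))"
      using sm0[of "\<bar>x\<bar>"] x g(2) by (simp add: abs_mult power_abs sums_iff)
    hence "summable (\<lambda>b. g b / fact b * x ^ b - g 0 * x ^ b)"
      using x by (intro summable_diff summable_norm_cancel[of "\<lambda>b. g b / fact b * x ^ b"] summable_mult summable_geometric) auto
    thus ?thesis by (simp add: a_def algebra_simps)
  qed
  have zero: "(\<Sum>b. a b * x ^ b) = 0" if x: "0 \<le> x" "x < 1" for x
  proof -
    have "(\<lambda>b. g b / fact b * x ^ b - g 0 * x ^ b) sums (g 0 / (1 - x) - g 0 * (1 / (1 - x)))"
      using x by (intro sums_diff sm0 sums_mult geometric_sums) auto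
    thus ?thesis by (simp add: a_def algebra_simps sums_iff)
  qed
  have "a b = 0"
  proof (rule ccontr)
    assume ab: "a b \<noteq> 0"
    have "\<exists>b'>0. a b' \<noteq> 0" using ab by (metis a_def div_by_1 fact_0 diff_self gr0I)
    then obtain b' where b': "b' > 0" "a b' \<noteq> 0" by blast
    obtain s where s: "s > 0" "\<And>z. \<lbrakk>norm z \<le> s; z \<noteq> 0\<rbrakk> \<Longrightarrow> (\<Sum>b. a b * z ^ b) \<noteq> 0"
    proof (rule powser_0_nonzero[of 1 0 a "\<lambda>x. \<Sum>b. a b * x ^ b" b'])
      show "(\<lambda>n. a n * (x - 0) ^ n) sums (\<Sum>b. a b * x ^ b)" if "norm (x - 0) < 1" for x :: real
        using sm[of x] that by (simp add: summable_sums)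
    qed (use zero[of 0] b' that in auto)
    define z where "z = min s (1 / 2)"
    have "(\<Sum>b. a b * z ^ b) = 0" using s(1) by (intro zero) (auto simp: z_def)
    moreover have "(\<Sum>b. a b * z ^ b) \<noteq> 0" using s(1) by (intro s(2)) (auto simp: z_def)
    ultimately show False by simp
  qed
  hence "g b = fact b * g 0" by (simp add: a_def field_simps)
  thus ?thesis using g(2)[of 0] by (simp add: g(1) ennreal_mult')
qed

lemma ball_moment_formula:
  obtains A where "A > 0"
    "\<And>b R. R > 0 \<Longrightarrow> ball_moment (j :: 'n::finite) b R = ennreal (A * fact b / fact (b + CARD('n)) * R ^ (b + CARD('n)))"
proof -
  define A where "A = enn2real (gauss_moment j 0)"
  have A: "gauss_moment j 0 = ennreal A" "A > 0"
    using gauss_moment_finite[of j 0] gauss_moment_0_pos[of j] by (auto simp: A_def enn2real_positive_iff)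
  have "ball_moment j b R = ennreal (A * fact b / fact (b + CARD('n)) * R ^ (b + CARD('n)))" if R: "R > 0" for b R
  proof -
    have "ball_moment j b 1 = ennreal (1 / fact (b + CARD('n))) * (ennreal (fact (b + CARD('n))) * ball_moment j b 1)"
      by (simp add: mult.assoc[symmetric] ennreal_mult'[symmetric])
    also have "\<dots> = ennreal (A * fact b / fact (b + CARD('n)))"
      unfolding gauss_moment_eq_ball_moment[symmetric] gauss_moment_eq[of j b] A(1)
      using A(2) by (simp add: ennreal_mult'[symmetric] mult.commute)
    finally show ?thesis using R A(2) by (simp add: ball_moment_scale[OF R] ennreal_mult'[symmetric] mult.commute)
  qed
  with A(2) show ?thesis by (rule that)
qed

text \<open>The weight is the integral of \<open>\<sigma> t\<^bsup>\<sigma> - 1\<^esup>\<close> over \<open>0 < t < 1 - \<parallel>Z\<parallel>\<^sup>2\<close>; exchanging the integrals leaves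
the moment of the ball of squared radius \<open>1 - t\<close>, and a Beta integral in \<open>t\<close>.\<close>

lemma ball_weighted_moment:
  assumes A: "\<And>b R. R > 0 \<Longrightarrow> ball_moment (j :: 'n::finite) b R = ennreal (A * fact b / fact (b + CARD('n)) * R ^ (b + CARD('n)))"
    and A0: "A > 0" and \<sigma>: "\<sigma> > 0"
  shows "(\<integral>\<^sup>+Z. ennreal (cmod (Z $ j) ^ (2 * a)) * ennreal ((1 - (norm Z)\<^sup>2) powr \<sigma>) * indicator {Z. norm Z < 1} Z
      \<partial>(lborel :: (complex ^ 'n) measure))
    = ennreal (A * fact a * (Gamma (\<sigma> + 1) / Gamma (\<sigma> + real (a + CARD('n)) + 1)))"
proof -
  let ?p = "\<lambda>Z::complex ^ 'n. ennreal (cmod (Z $ j) ^ (2 * a))"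
  let ?n = "a + CARD('n)"
  define w where "w t = ennreal (\<sigma> * t powr (\<sigma> - 1)) * indicator {0<..<1} t" for t :: real
  have [measurable]: "w \<in> borel_measurable borel" unfolding w_def by measurable
  have w: "(\<integral>\<^sup>+t. w t * indicator {x. (norm (fst x))\<^sup>2 < 1 - snd x} (Z, t) \<partial>lborel)
      = ennreal ((1 - (norm Z)\<^sup>2) powr \<sigma>) * indicator {Z. norm Z < 1} Z" for Z :: "complex ^ 'n"
  proof (cases "norm Z < 1")
    case True
    define c where "c = 1 - (norm Z)\<^sup>2"
    have c: "0 < c" "c \<le> 1" using True by (auto simp: c_def abs_square_less_1)
    have "((\<lambda>t. \<sigma> * t powr (\<sigma> - 1)) has_integral \<sigma> * (c powr (\<sigma> - 1 + 1) / (\<sigma> - 1 + 1))) {0..c}"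
      using \<sigma> c by (intro has_integral_mult_right has_integral_powr_from_0) auto
    hence "(\<integral>\<^sup>+t. ennreal (indicator {0..c} t * (\<sigma> * t powr (\<sigma> - 1))) \<partial>lborel) = ennreal (c powr \<sigma>)"
      using \<sigma> by (subst nn_integral_has_integral_lebesgue) auto
    moreover have "(\<integral>\<^sup>+t. w t * indicator {x. (norm (fst x))\<^sup>2 < 1 - snd x} (Z, t) \<partial>lborel)
      = (\<integral>\<^sup>+t. ennreal (indicator {0..c} t * (\<sigma> * t powr (\<sigma> - 1))) \<partial>lborel)"
    proof (rule nn_integral_cong_AE)
      show "AE t in lborel. w t * indicator {x. (norm (fst x))\<^sup>2 < 1 - snd x} (Z, t)
          = ennreal (indicator {0..c} t * (\<sigma> * t powr (\<sigma> - 1)))"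
        using AE_lborel_singleton[of c]
      proof eventually_elim
        case (elim t)
        have *: "(norm Z)\<^sup>2 < 1 - t \<longleftrightarrow> t < c" by (auto simp: c_def)
        show ?case
        proof (cases "t = 0")
          case False
          thus ?thesis using elim c * by (auto simp: w_def indicator_def)
        qed (auto simp: w_def)
      qed
    qed
    ultimately show ?thesis using True by (simp add: c_def)
  next
    case False
    hence "1 \<le> (norm Z)\<^sup>2" by (simp add: one_le_power)
    hence "(\<lambda>t. w t * indicator {x. (norm (fst x))\<^sup>2 < 1 - snd x} (Z, t)) = (\<lambda>_. 0)"
      by (auto simp: w_def indicator_def fun_eq_iff)
    thus ?thesis using False by simp
  qed
  have "(\<integral>\<^sup>+Z. ?p Z * ennreal ((1 - (norm Z)\<^sup>2) powr \<sigma>) * indicator {Z. norm Z < 1} Z \<partial>(lborel :: (complex ^ 'n) measure))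
     = (\<integral>\<^sup>+Z. ?p Z * (\<integral>\<^sup>+t. w t * indicator {x. (norm (fst x))\<^sup>2 < 1 - snd x} (Z, t) \<partial>lborel) \<partial>lborel)"
    by (simp add: w mult.assoc)
  also have "\<dots> = (\<integral>\<^sup>+Z. (\<integral>\<^sup>+t. ?p Z * (w t * indicator {x. (norm (fst x))\<^sup>2 < 1 - snd x} (Z, t)) \<partial>lborel) \<partial>lborel)"
    by (rule nn_integral_cong, rule nn_integral_cmult[symmetric]) measurable
  also have "\<dots> = (\<integral>\<^sup>+t. (\<integral>\<^sup>+Z. ?p Z * (w t * indicator {x. (norm (fst x))\<^sup>2 < 1 - snd x} (Z, t)) \<partial>lborel) \<partial>lborel)"
    by (rule lborel_pair.Fubini'[symmetric]) measurable
  also have "\<dots> = (\<integral>\<^sup>+t. w t * ball_moment j a (1 - t) \<partial>lborel)"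
  proof (rule nn_integral_cong)
    fix t :: real
    have "(\<integral>\<^sup>+Z. ?p Z * (w t * indicator {x. (norm (fst x))\<^sup>2 < 1 - snd x} (Z, t)) \<partial>lborel)
       = (\<integral>\<^sup>+Z. w t * (?p Z * indicator {Z. (norm Z)\<^sup>2 < 1 - t} Z) \<partial>lborel)"
      by (rule nn_integral_cong) (simp add: indicator_def mult_ac)
    also have "\<dots> = w t * ball_moment j a (1 - t)"
      unfolding ball_moment_def by (rule nn_integral_cmult) measurable
    finally show "(\<integral>\<^sup>+Z. ?p Z * (w t * indicator {x. (norm (fst x))\<^sup>2 < 1 - snd x} (Z, t)) \<partial>lborel) = \<dots>" .
  qed
  also have "\<dots> = (\<integral>\<^sup>+t. ennreal (indicator {0..1} t * (A * fact a / fact ?n * \<sigma> * (t powr (\<sigma> - 1) * (1 - t) powr (real ?n + 1 - 1)))) \<partial>lborel)"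
  proof (rule nn_integral_cong_AE)
    show "AE t in lborel. w t * ball_moment j a (1 - t) = ennreal (indicator {0..1} t * (A * fact a / fact ?n * \<sigma> * (t powr (\<sigma> - 1) * (1 - t) powr (real ?n + 1 - 1))))"
      using AE_lborel_singleton[of 0] AE_lborel_singleton[of 1]
    proof eventually_elim
      case (elim t)
      show ?case
      proof (cases "t \<in> {0<..<1}")
        case True
        thus ?thesis using A0 \<sigma> A[of "1 - t" a]
          by (simp add: w_def ennreal_mult'[symmetric] powr_realpow[symmetric] mult_ac)
      next
        case False
        thus ?thesis using elim by (auto simp: w_def indicator_def)
      qed
    qed
  qed
  also have "\<dots> = ennreal (A * fact a / fact ?n * \<sigma> * Beta \<sigma> (real ?n + 1))"
  proof (rule nn_integral_has_integral_lebesgue)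
    show "((\<lambda>t. A * fact a / fact ?n * \<sigma> * (t powr (\<sigma> - 1) * (1 - t) powr (real ?n + 1 - 1)))
       has_integral A * fact a / fact ?n * \<sigma> * Beta \<sigma> (real ?n + 1)) {0..1}"
      using \<sigma> by (intro has_integral_mult_right has_integral_Beta_real) auto
  qed (use A0 \<sigma> in auto)
  also have "A * fact a / fact ?n * \<sigma> * Beta \<sigma> (real ?n + 1)
     = A * fact a * (Gamma (\<sigma> + 1) / Gamma (\<sigma> + real ?n + 1))"
  proof -
    have "Gamma (real ?n + 1) = fact ?n" using Gamma_fact[of ?n, where 'a=real] by (simp add: add.commute)
    moreover have "Gamma (\<sigma> + 1) = \<sigma> * Gamma \<sigma>" using \<sigma> by (intro Gamma_plus1) (auto dest: nonpos_Ints_nonpos)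
    moreover have "\<sigma> + (real ?n + 1) = \<sigma> + real ?n + 1" by simp
    ultimately show ?thesis unfolding Beta_def by (simp add: field_simps)
  qed
  finally show ?thesis .
qed

section \<open>Moments over the domain\<close>

lemma Omega_hat_iff:
  "v \<in> Omega_hat \<mu> \<longleftrightarrow> norm (base_part v) < 1 \<and> (norm (fibre_part v))\<^sup>2 < (1 - (norm (base_part v))\<^sup>2) powr \<mu>"
  by (auto simp: Omega_hat_def Omega_def)

lemma base_part_nth [simp]: "base_part v $ i = v $ Inl i" by (simp add: base_part_def)
lemma fibre_part_nth [simp]: "fibre_part v $ i = v $ Inr i" by (simp add: fibre_part_def)

lemma continuous_on_base_part [continuous_intros]: "continuous_on S base_part"
  unfolding base_part_def[abs_def] by (intro continuous_intros)
lemma continuous_on_fibre_part [continuous_intros]: "continuous_on S fibre_part"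
  unfolding fibre_part_def[abs_def] by (intro continuous_intros)

lemma open_Omega_hat: "open (Omega_hat \<mu> :: (complex ^ (2 + 'm::finite)) set)"
proof -
  let ?V = "{v :: complex ^ (2 + 'm). norm (base_part v) < 1}"
  have V: "open ?V" by (intro open_Collect_less continuous_intros)
  let ?g = "\<lambda>v :: complex ^ (2 + 'm). (1 - (norm (base_part v))\<^sup>2) powr \<mu> - (norm (fibre_part v))\<^sup>2"
  have "continuous_on ?V ?g"
    by (intro continuous_intros) (auto simp: power2_eq_1_iff, metis norm_ge_zero neg_0_le_iff_le not_one_le_zero)
  hence "open (?V \<inter> ?g -` {0<..})"
    using V by (rule continuous_open_preimage) simp
  also have "?V \<inter> ?g -` {0<..} = Omega_hat \<mu>"
    by (auto simp: Omega_hat_iff)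
  finally show ?thesis .
qed

definition join_parts :: "(complex ^ 2) \<times> (complex ^ 'm::finite) \<Rightarrow> complex ^ (2 + 'm)" where
  "join_parts p = (\<chi> i. case i of Inl k \<Rightarrow> fst p $ k | Inr l \<Rightarrow> snd p $ l)"

lemma join_parts_simps [simp]:
  "join_parts p $ Inl k = fst p $ k" "join_parts p $ Inr l = snd p $ l"
  "base_part (join_parts p) = fst p" "fibre_part (join_parts p) = snd p"
  "join_parts (base_part v, fibre_part v) = v"
  by (auto simp: join_parts_def vec_eq_iff split: sum.splits)

lemma linear_join_parts: "linear join_parts"
proof (rule linearI)
  show "join_parts (p + q) = join_parts p + join_parts q" for p q
    unfolding vec_eq_iff by (simp add: join_parts_def split: sum.splits)
  show "join_parts (r *\<^sub>R p) = r *\<^sub>R join_parts p" for r p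
    unfolding vec_eq_iff by (simp add: join_parts_def split: sum.splits)
qed

lemma bij_join_parts: "bij join_parts"
  by (rule bij_betw_byWitness[where f' = "\<lambda>v. (base_part v, fibre_part v)"]) auto

text \<open>Integrating over the fibre first gives a ball moment of squared radius \<open>(1 - \<parallel>z\<parallel>\<^sup>2)\<^bsup>\<mu>\<^esup>\<close>, hence the weight
\<open>(1 - \<parallel>z\<parallel>\<^sup>2)\<^bsup>\<mu> (b + m)\<^esup>\<close> on the base. The constant \<open>C\<close> is left unspecified: only the dependence on
\<open>a\<close> and \<open>b\<close> matters for zeros of the kernel.\<close>

lemma Omega_hat_moment:
  fixes j :: "'m::finite"
  assumes \<mu>: "\<mu> > 0"
  obtains C where "C > 0" "\<And>a b.
    (\<integral>\<^sup>+v. ennreal (cmod (v $ Inl 1) ^ (2 * a) * cmod (v $ Inr j) ^ (2 * b)) * indicator (Omega_hat \<mu>) v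
        \<partial>(lborel :: (complex ^ (2 + 'm)) measure))
     = ennreal (C * (fact a * Gamma (\<mu> * (b + CARD('m)) + 1) / Gamma (\<mu> * (b + CARD('m)) + a + 3)
                    * (fact b / fact (b + CARD('m)))))"
proof -
  obtain A where A: "A > 0"
    "\<And>b R. R > 0 \<Longrightarrow> ball_moment (1::2) b R = ennreal (A * fact b / fact (b + CARD(2)) * R ^ (b + CARD(2)))"
    by (rule ball_moment_formula[of "1::2"]) blast
  obtain B where B: "B > 0"
    "\<And>b R. R > 0 \<Longrightarrow> ball_moment j b R = ennreal (B * fact b / fact (b + CARD('m)) * R ^ (b + CARD('m)))"
    by (rule ball_moment_formula[of j]) blast
  obtain c where c: "c > 0" "distr lborel borel (join_parts :: _ \<Rightarrow> complex ^ (2 + 'm)) = density lborel (\<lambda>_. ennreal c)"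
    using distr_lborel_linear_bij[OF linear_join_parts bij_join_parts] by blast
  have [measurable]: "Omega_hat \<mu> \<in> sets (borel :: (complex ^ (2 + 'm)) measure)"
    by (rule borel_open, rule open_Omega_hat)
  have jm[measurable]: "(join_parts :: _ \<Rightarrow> complex ^ (2 + 'm)) \<in> borel_measurable borel"
    using linear_join_parts by (intro borel_measurable_continuous_onI linear_continuous_on) (simp add: linear_conv_bounded_linear)
  show ?thesis
  proof (rule that[of "A * B / c"])
    show "A * B / c > 0" using A B c by simp
  next
    fix a b
    let ?f = "\<lambda>v :: complex ^ (2 + 'm). ennreal (cmod (v $ Inl 1) ^ (2 * a) * cmod (v $ Inr j) ^ (2 * b)) * indicator (Omega_hat \<mu>) v"
    let ?I = "integral\<^sup>N lborel ?f"
    let ?\<sigma> = "\<mu> * (b + CARD('m))"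
    let ?px = "\<lambda>z::complex ^ 2. ennreal (cmod (z $ 1) ^ (2 * a))"
    let ?py = "\<lambda>Z::complex ^ 'm. ennreal (cmod (Z $ j) ^ (2 * b))"
    have fm[measurable]: "?f \<in> borel_measurable borel" by measurable
    have "ennreal c * ?I = integral\<^sup>N (distr lborel borel join_parts) ?f"
      unfolding c(2) by (simp add: nn_integral_density nn_integral_cmult)
    also have "\<dots> = (\<integral>\<^sup>+p. ?f (join_parts p) \<partial>(lborel \<Otimes>\<^sub>M lborel))"
      by (simp add: nn_integral_distr lborel_prod)
    also have "\<dots> = (\<integral>\<^sup>+z. \<integral>\<^sup>+Z. ?f (join_parts (z, Z)) \<partial>lborel \<partial>lborel)"
    proof (rule lborel.nn_integral_fst[symmetric])
      have "(\<lambda>p. ?f (join_parts p)) \<in> borel_measurable borel" by measurable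
      thus "(\<lambda>p. ?f (join_parts p)) \<in> borel_measurable (lborel \<Otimes>\<^sub>M lborel)"
        by (simp add: lborel_prod)
    qed
    also have "\<dots> = (\<integral>\<^sup>+z. ennreal (B * fact b / fact (b + CARD('m))) * (?px z * ennreal ((1 - (norm z)\<^sup>2) powr ?\<sigma>) * indicator {z. norm z < 1} z) \<partial>lborel)"
    proof (rule nn_integral_cong)
      fix z :: "complex ^ 2"
      show "(\<integral>\<^sup>+Z. ?f (join_parts (z, Z)) \<partial>lborel) = ennreal (B * fact b / fact (b + CARD('m))) * (?px z * ennreal ((1 - (norm z)\<^sup>2) powr ?\<sigma>) * indicator {z. norm z < 1} z)"
      proof (cases "norm z < 1")
        case True
        hence pos: "1 - (norm z)\<^sup>2 > 0" by (simp add: abs_square_less_1)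
        define R where "R = (1 - (norm z)\<^sup>2) powr \<mu>"
        have R: "R > 0" using pos by (simp add: R_def)
        have "(\<integral>\<^sup>+Z. ?f (join_parts (z, Z)) \<partial>lborel) = (\<integral>\<^sup>+Z. ?px z * (?py Z * indicator {Z. (norm Z)\<^sup>2 < R} Z) \<partial>lborel)"
          using True by (intro nn_integral_cong) (simp add: ennreal_mult' indicator_def Omega_hat_iff R_def)
        also have "\<dots> = ?px z * ball_moment j b R"
          unfolding ball_moment_def by (rule nn_integral_cmult) measurable
        also have "\<dots> = ?px z * ennreal (B * fact b / fact (b + CARD('m)) * R ^ (b + CARD('m)))"
          by (simp add: B(2)[OF R])
        also have "R ^ (b + CARD('m)) = (1 - (norm z)\<^sup>2) powr ?\<sigma>"
          using pos by (simp add: R_def powr_powr flip: powr_realpow)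
        also have "ennreal (B * fact b / fact (b + CARD('m)) * (1 - (norm z)\<^sup>2) powr ?\<sigma>)
            = ennreal (B * fact b / fact (b + CARD('m))) * ennreal ((1 - (norm z)\<^sup>2) powr ?\<sigma>)"
          using B(1) by (intro ennreal_mult') simp
        finally show ?thesis using True
          by (simp add: mult_ac)
      next
        case False
        hence "(\<lambda>Z. ?f (join_parts (z, Z))) = (\<lambda>_. 0)"
          by (auto simp: fun_eq_iff indicator_def Omega_hat_iff)
        thus ?thesis using False by simp
      qed
    qed
    also have "\<dots> = ennreal (B * fact b / fact (b + CARD('m))) *
        (\<integral>\<^sup>+z. ?px z * ennreal ((1 - (norm z)\<^sup>2) powr ?\<sigma>) * indicator {z. norm z < 1} z \<partial>lborel)"
      by (rule nn_integral_cmult) measurable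
    also have "\<dots> = ennreal (B * fact b / fact (b + CARD('m))) * ennreal (A * fact a * (Gamma (?\<sigma> + 1) / Gamma (?\<sigma> + real (a + CARD(2)) + 1)))"
      using \<mu> by (subst ball_weighted_moment[OF A(2) A(1)]) (auto intro!: mult_pos_pos add_nonneg_pos)
    also have "\<dots> = ennreal (c * (A * B / c * (fact a * Gamma (?\<sigma> + 1) / Gamma (?\<sigma> + a + 3) * (fact b / fact (b + CARD('m))))))"
      using A(1) B(1) c(1) by (simp add: ennreal_mult'[symmetric] mult_ac add_ac)
    finally have "ennreal (1 / c) * (ennreal c * ?I) = ennreal (1 / c) * \<dots>" by simp
    thus "?I = ennreal (A * B / c * (fact a * Gamma (?\<sigma> + 1) / Gamma (?\<sigma> + a + 3) * (fact b / fact (b + CARD('m)))))"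
      using c(1) by (simp add: mult.assoc[symmetric] ennreal_mult'[symmetric])
  qed
qed

section \<open>Averages over circle actions\<close>

definition scale_coords :: "'n set \<Rightarrow> complex \<Rightarrow> complex ^ 'n \<Rightarrow> complex ^ 'n" where
  "scale_coords S s v = (\<chi> i. if i \<in> S then s * v $ i else v $ i)"

lemma scale_coords_nth [simp]: "scale_coords S s v $ i = (if i \<in> S then s * v $ i else v $ i)"
  by (simp add: scale_coords_def)

lemma linear_scale_coords: "linear (scale_coords S s)"
  by (rule linearI) (auto simp: vec_eq_iff algebra_simps)

lemma norm_scale_coords:
  assumes "cmod s = 1" shows "norm (scale_coords S s v) = norm v"
  unfolding norm_vec_def by (intro L2_set_cong) (auto simp: norm_mult assms)

lemma distr_scale_coords:
  assumes "cmod s = 1"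
  shows "distr lborel borel (scale_coords S s :: complex ^ 'n::finite \<Rightarrow> _) = lborel"
  using assms by (intro distr_lborel_isometry linear_scale_coords norm_scale_coords)

lemma continuous_on_scale_coords [continuous_intros]:
  assumes "continuous_on A g" "continuous_on A h"
  shows "continuous_on A (\<lambda>x. scale_coords S (g x) (h x))"
  unfolding scale_coords_def
proof (rule continuous_on_vec_lambda)
  fix i show "continuous_on A (\<lambda>x. if i \<in> S then g x * h x $ i else h x $ i)"
    using assms by (cases "i \<in> S") (auto intro!: continuous_intros)
qed

lemma taylor_coefficient_circle:
  assumes hol: "f holomorphic_on V" and V: "cball 0 1 \<subseteq> V"
  shows "((\<lambda>t. f (cis (2 * pi * t)) * cnj (cis (2 * pi * t)) ^ n) has_integral (deriv ^^ n) f 0 / fact n) {0..1}"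
proof -
  have circ: "circlepath 0 1 t = cis (2 * pi * t)" for t
    by (simp add: circlepath_def part_circlepath_def linepath_def cis_conv_exp algebra_simps)
  have "((\<lambda>u. f u / (u - 0) ^ Suc n) has_contour_integral ((2 * pi * \<i>) / (fact n) * (deriv ^^ n) f 0)) (circlepath 0 1)"
    using V by (intro Cauchy_has_contour_integral_higher_derivative_circlepath)
      (auto intro!: holomorphic_on_imp_continuous_on holomorphic_on_subset[OF hol])
  hence "((\<lambda>t. f (cis (2 * pi * t)) / cis (2 * pi * t) ^ Suc n * (2 * pi * \<i> * cis (2 * pi * t)))
      has_integral ((2 * pi * \<i>) / (fact n) * (deriv ^^ n) f 0)) {0..1}"
    unfolding has_contour_integral_def
    by (rule has_integral_eq[rotated])
       (simp add: vector_derivative_circlepath01 circ cis_conv_exp algebra_simps)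
  hence "((\<lambda>t. 1 / (2 * pi * \<i>) * (f (cis (2 * pi * t)) / cis (2 * pi * t) ^ Suc n * (2 * pi * \<i> * cis (2 * pi * t))))
      has_integral 1 / (2 * pi * \<i>) * ((2 * pi * \<i>) / (fact n) * (deriv ^^ n) f 0)) {0..1}"
    by (rule has_integral_mult_right)
  moreover have "1 / (2 * pi * \<i>) * (f (cis (2 * pi * t)) / cis (2 * pi * t) ^ Suc n * (2 * pi * \<i> * cis (2 * pi * t)))
      = f (cis (2 * pi * t)) * cnj (cis (2 * pi * t)) ^ n" for t
    by (simp add: cis_cnj field_simps flip: cis_inverse)
  ultimately show ?thesis by simp
qed

text \<open>Rotating the coordinates in \<open>S\<close> by \<open>e\<^sup>i\<^sup>\<theta>\<close> preserves the integral and multiplies \<open>p\<close> by \<open>e\<^sup>i\<^sup>n\<^sup>\<theta>\<close>. Averaging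
over \<open>\<theta>\<close> and using Fubini replaces \<open>f\<close> by its average against \<open>e\<^sup>-\<^sup>i\<^sup>n\<^sup>\<theta>\<close>, which Cauchy's formula
identifies with the \<open>n\<close>-th Taylor coefficient along the complex line in direction \<open>S\<close>. The closed disc
of scalings stays in \<open>U\<close>, so the unit circle is an admissible contour at every point of \<open>U\<close>.\<close>

lemma circle_average:
  fixes U :: "(complex ^ 'n::finite) set" and f p :: "complex ^ 'n \<Rightarrow> complex"
  assumes U: "open U" and sc: "\<And>s v. v \<in> U \<Longrightarrow> cmod s \<le> 1 \<Longrightarrow> scale_coords S s v \<in> U"
    and f: "continuous_on U f" "set_integrable lborel U f"
    and hol: "\<And>v. v \<in> U \<Longrightarrow> (\<lambda>s. f (scale_coords S s v)) holomorphic_on {s. scale_coords S s v \<in> U}"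
    and p[measurable]: "p \<in> borel_measurable borel" and pB: "\<And>v. v \<in> U \<Longrightarrow> cmod (p v) \<le> B"
    and ps: "\<And>s v. cmod s = 1 \<Longrightarrow> p (scale_coords S s v) = s ^ n * p v"
  defines "F \<equiv> \<lambda>v. (deriv ^^ n) (\<lambda>s. f (scale_coords S s v)) 0 / fact n"
  shows "set_integrable lborel U F"
    and "(LINT v:U|lborel. f v * cnj (p v)) = (LINT v:U|lborel. F v * cnj (p v))"
proof -
  have [measurable]: "U \<in> sets borel" using U by simp
  define e where "e t = cis (2 * pi * t)" for t
  have e1: "cmod (e t) = 1" for t by (simp add: e_def)
  have [measurable]: "cnj \<in> borel_measurable borel"
    by (intro borel_measurable_continuous_onI continuous_intros)
  have [measurable]: "e \<in> borel_measurable borel" unfolding e_def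
    by (intro borel_measurable_continuous_onI continuous_intros)
  have inU: "scale_coords S s v \<in> U \<longleftrightarrow> v \<in> U" if "cmod s = 1" for s v
  proof
    assume "scale_coords S s v \<in> U"
    hence "scale_coords S (cnj s) (scale_coords S s v) \<in> U" using that sc[of "scale_coords S s v" "cnj s"] by simp
    moreover have "cnj s * s = 1" using that complex_norm_square[of s] by (simp add: mult.commute)
    hence "scale_coords S (cnj s) (scale_coords S s v) = v"
      by (auto simp: vec_eq_iff mult.assoc[symmetric])
    ultimately show "v \<in> U" by simp
  qed (use that in \<open>auto intro: sc\<close>)
  define g where "g v = indicator U v *\<^sub>R f v" for v
  have g: "integrable lborel g" using f(2) by (simp add: g_def[abs_def] set_integrable_def)
  have gm[measurable]: "g \<in> borel_measurable borel" using g by auto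
  \<comment> \<open>the case \<open>q = 1\<close> gives integrability, since \<open>p\<close> is bounded; the case \<open>q = cnj p\<close> gives the identity\<close>
  define G where "G q = (\<lambda>(t, v). indicator {0..1::real} t *\<^sub>R (g (scale_coords S (e t) v) * cnj (e t) ^ n * q v))"
    for q :: "complex ^ 'n \<Rightarrow> complex"
  have Sm[measurable]: "(\<lambda>x. scale_coords S (e (fst x)) (snd x)) \<in> borel_measurable (borel \<Otimes>\<^sub>M borel)"
    unfolding borel_prod e_def by (intro borel_measurable_continuous_onI continuous_intros)
  have Sm'[measurable]: "scale_coords S s \<in> borel_measurable borel" for s :: complex
    by (intro borel_measurable_continuous_onI continuous_intros)
  have Gm: "G q \<in> borel_measurable (lborel \<Otimes>\<^sub>M lborel)" if [measurable]: "q \<in> borel_measurable borel" for q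
  proof -
    have "(\<lambda>x. q (snd x)) \<in> borel_measurable (borel \<Otimes>\<^sub>M borel)" by measurable
    hence "G q \<in> borel_measurable (borel \<Otimes>\<^sub>M borel)"
      unfolding G_def split_beta' by measurable
    thus ?thesis
      by (simp add: measurable_cong_sets[OF sets_pair_measure_cong[OF sets_lborel sets_lborel] refl])
  qed
  have iso: "integrable lborel (\<lambda>v. h (scale_coords S s v))"
    "(\<integral>v. h (scale_coords S s v) \<partial>lborel) = (\<integral>v. h v \<partial>lborel)"
    if h: "integrable lborel h" and s: "cmod s = 1" for h :: "complex ^ 'n \<Rightarrow> 'z::{banach, second_countable_topology}" and s
  proof -
    have [measurable]: "h \<in> borel_measurable borel" using h by auto
    show "integrable lborel (\<lambda>v. h (scale_coords S s v))"
      using h by (subst integrable_distr_eq[symmetric, where N = borel]) (auto simp: distr_scale_coords s)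
    show "(\<integral>v. h (scale_coords S s v) \<partial>lborel) = (\<integral>v. h v \<partial>lborel)"
      by (subst (2) distr_scale_coords[of s S, symmetric, OF s], subst integral_distr) auto
  qed
  have G1: "integrable (lborel \<Otimes>\<^sub>M lborel) (G (\<lambda>_. 1))"
  proof (rule lborel_pair.Fubini_integrable)
    show "G (\<lambda>_. 1) \<in> borel_measurable (lborel \<Otimes>\<^sub>M lborel)" by (rule Gm) simp
    have "(\<integral>v. norm (G (\<lambda>_. 1) (t, v)) \<partial>lborel) = indicator {0..1} t * (\<integral>v. norm (g v) \<partial>lborel)" for t
      using iso(2)[of "\<lambda>v. norm (g v)" "e t"] g
      by (simp add: G_def norm_mult norm_power e1)
    thus "integrable lborel (\<lambda>t. \<integral>v. norm (G (\<lambda>_. 1) (t, v)) \<partial>lborel)"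
      by simp
    show "AE t in lborel. integrable lborel (\<lambda>v. G (\<lambda>_. 1) (t, v))"
      by (rule AE_I2) (auto simp: G_def intro!: integrable_mult_left iso(1) g e1)
  qed
  have Gi: "integrable (lborel \<Otimes>\<^sub>M lborel) (G q)"
    if q: "q \<in> borel_measurable borel" "\<And>v. v \<in> U \<Longrightarrow> cmod (q v) \<le> C" for q C
  proof (rule Bochner_Integration.integrable_bound)
    show "integrable (lborel \<Otimes>\<^sub>M lborel) (\<lambda>x. C *\<^sub>R G (\<lambda>_. 1) x)" using G1 by (rule integrable_scaleR_right)
    show "AE x in lborel \<Otimes>\<^sub>M lborel. norm (G q x) \<le> norm (C *\<^sub>R G (\<lambda>_. 1) x)"
    proof (rule AE_I2)
      fix x :: "real \<times> (complex ^ 'n)"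
      obtain t v where x: "x = (t, v)" by (cases x)
      show "norm (G q x) \<le> norm (C *\<^sub>R G (\<lambda>_. 1) x)"
      proof (cases "v \<in> U")
        case True
        hence "cmod (q v) \<le> \<bar>C\<bar>" using q(2)[of v] by simp
        hence "norm (g (scale_coords S (e t) v)) * cmod (q v) \<le> \<bar>C\<bar> * norm (g (scale_coords S (e t) v))"
          by (subst mult.commute, intro mult_right_mono) auto
        thus ?thesis
          by (cases "t \<in> {0..1}") (simp_all add: x G_def norm_mult norm_power e1)
      next
        case False
        hence "g (scale_coords S (e t) v) = 0" by (simp add: g_def inU e1)
        thus ?thesis by (simp add: x G_def)
      qed
    qed
  qed (use Gm q in auto)
  have inner: "(\<integral>t. G q (t, v) \<partial>lborel) = indicator U v *\<^sub>R (F v * q v)" for q v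
  proof (cases "v \<in> U")
    case True
    let ?V = "{s. scale_coords S s v \<in> U}"
    have V: "cball 0 1 \<subseteq> ?V" using sc True by auto
    let ?h = "\<lambda>t. f (scale_coords S (e t) v) * cnj (e t) ^ n"
    have I: "(?h has_integral F v) {0..1}"
      unfolding e_def F_def
      by (rule taylor_coefficient_circle[OF hol[OF True] V, where n = n])
    have "continuous_on {0..1} (\<lambda>t. (\<lambda>s. f (scale_coords S s v)) (e t))"
    proof (rule continuous_on_compose2[OF holomorphic_on_imp_continuous_on[OF hol[OF True]]])
      show "continuous_on {0..1} e" unfolding e_def by (intro continuous_intros)
      show "e ` {0..1} \<subseteq> ?V" using inU e1 True by auto
    qed
    hence "continuous_on {0..1} ?h"
      by (auto simp: e_def intro!: continuous_intros)
    hence "set_integrable lborel {0..1} ?h" by (rule borel_integrable_atLeastAtMost')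
    from set_borel_integral_eq_integral(2)[OF this] I
    have "(LINT t:{0..1}|lborel. ?h t) = F v" by (simp add: integral_unique)
    hence "(\<integral>t. (indicator {0..1} t *\<^sub>R ?h t) * q v \<partial>lborel) = F v * q v"
      unfolding set_lebesgue_integral_def by (subst integral_mult_left_zero) simp
    thus ?thesis using True by (simp add: G_def g_def inU e1 mult_ac)
  next
    case False
    hence "g (scale_coords S (e t) v) = 0" for t by (simp add: g_def inU e1)
    thus ?thesis using False by (simp add: G_def)
  qed
  show "set_integrable lborel U F"
    using lborel_pair.integrable_snd[of "\<lambda>t v. G (\<lambda>_. 1) (t, v)"] G1 inner[of "\<lambda>_. 1"]
    by (simp add: set_integrable_def)
  define I where "I = (\<integral>v. g v * cnj (p v) \<partial>lborel)"
  have gp: "integrable lborel (\<lambda>v. g v * cnj (p v))"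
  proof (rule Bochner_Integration.integrable_bound)
    show "integrable lborel (\<lambda>v. B *\<^sub>R g v)" using g by (rule integrable_scaleR_right)
    show "AE v in lborel. norm (g v * cnj (p v)) \<le> norm (B *\<^sub>R g v)"
    proof (rule AE_I2)
      fix v show "norm (g v * cnj (p v)) \<le> norm (B *\<^sub>R g v)"
        using pB[of v] by (auto simp: g_def indicator_def norm_mult mult.commute[of "cmod (f v)"] intro!: mult_right_mono)
    qed
  qed simp
  have outer: "(\<integral>v. G (\<lambda>v. cnj (p v)) (t, v) \<partial>lborel) = indicator {0..1} t *\<^sub>R I" for t
  proof -
    have "(\<lambda>v. g (scale_coords S (e t) v) * cnj (e t) ^ n * cnj (p v))
        = (\<lambda>v. g (scale_coords S (e t) v) * cnj (p (scale_coords S (e t) v)))"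
      by (simp add: ps e1 mult.assoc)
    hence "(\<integral>v. g (scale_coords S (e t) v) * cnj (e t) ^ n * cnj (p v) \<partial>lborel) = I"
      using iso(2)[OF gp e1, of t] by (simp add: I_def)
    thus ?thesis by (simp add: G_def)
  qed
  have "(\<integral>v. (\<integral>t. G (\<lambda>v. cnj (p v)) (t, v) \<partial>lborel) \<partial>lborel)
      = (\<integral>t. (\<integral>v. G (\<lambda>v. cnj (p v)) (t, v) \<partial>lborel) \<partial>lborel)"
    using lborel_pair.Fubini_integral[of "\<lambda>t v. G (\<lambda>v. cnj (p v)) (t, v)"] Gi[of "\<lambda>v. cnj (p v)" B] pB
    by simp
  also have "\<dots> = I" by (simp add: outer)
  finally show "(LINT v:U|lborel. f v * cnj (p v)) = (LINT v:U|lborel. F v * cnj (p v))"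
    by (simp add: inner set_lebesgue_integral_def I_def g_def)
qed

section \<open>Holomorphic functions on the domain and their monomial coefficients\<close>

lemma holomorphic_several_imp_continuous_on:
  "holomorphic_several f U \<Longrightarrow> continuous_on U f"
  unfolding holomorphic_several_def
  by (metis continuous_at_imp_continuous_on has_derivative_continuous)

lemma holomorphic_several_on_line:
  fixes f :: "complex ^ 'n::finite \<Rightarrow> complex"
  assumes f: "holomorphic_several f U" and "\<And>s. s \<in> V \<Longrightarrow> g s \<in> U" and g: "\<And>s. g s = c + s *s u"
  shows "(\<lambda>s. f (g s)) holomorphic_on V"
  unfolding holomorphic_on_def
proof
  fix s assume "s \<in> V"
  with assms obtain f' where f': "(f has_derivative f') (at (g s))" "\<And>c v. f' (c *s v) = c * f' v"
    unfolding holomorphic_several_def by meson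
  have "linear (\<lambda>h :: complex. h *s u)"
    by (rule linearI) (auto simp: vec_eq_iff algebra_simps)
  hence "bounded_linear (\<lambda>h :: complex. h *s u)" by (simp add: linear_conv_bounded_linear)
  hence "(g has_derivative (\<lambda>h. h *s u)) (at s)"
    unfolding g[abs_def] by (auto intro!: derivative_eq_intros bounded_linear_imp_has_derivative)
  from diff_chain_at[OF this f'(1)] have "((\<lambda>s. f (g s)) has_derivative (\<lambda>h. f' u * h)) (at s)"
    by (simp add: o_def f'(2) mult.commute)
  hence "((\<lambda>s. f (g s)) has_field_derivative f' u) (at s)"
    by (simp add: has_field_derivative_def)
  thus "(\<lambda>s. f (g s)) field_differentiable at s within V"
    using field_differentiable_at_within field_differentiable_def by blast
qed

text \<open>Locally the coefficient is a Cauchy integral over a fixed circle in \<open>y\<close>; it is continuous in \<open>x\<close>,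
and its integral over a triangle vanishes after exchanging the two contour integrals, so Morera's
theorem applies.\<close>

lemma holomorphic_taylor_coefficient_in_parameter:
  fixes h :: "complex \<Rightarrow> complex \<Rightarrow> complex"
  assumes W: "open W" and h: "continuous_on W (\<lambda>(x, y). h x y)"
    and hx: "\<And>y. (\<lambda>x. h x y) holomorphic_on {x. (x, y) \<in> W}"
    and hy: "\<And>x. (\<lambda>y. h x y) holomorphic_on {y. (x, y) \<in> W}"
    and V: "\<And>x. x \<in> V \<Longrightarrow> (x, 0) \<in> W"
  shows "(\<lambda>x. (deriv ^^ b) (\<lambda>y. h x y) 0) holomorphic_on V"
proof -
  have "\<exists>d>0. (\<lambda>x. (deriv ^^ b) (\<lambda>y. h x y) 0) holomorphic_on ball x0 d" if x0: "x0 \<in> V" for x0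
  proof -
    obtain e where e: "e > 0" "ball (x0, 0) e \<subseteq> W"
      using W V[OF x0] openE by blast
    define r where "r = e / 2"
    have r: "r > 0" using e by (simp add: r_def)
    have box: "(x, y) \<in> W" if "x \<in> ball x0 r" "cmod y \<le> r" for x y
    proof -
      have "dist (x0, 0) (x, y) \<le> dist x0 x + dist 0 y"
        unfolding dist_Pair_Pair by (rule sqrt_sum_squares_le_sum) auto
      also have "\<dots> < e" using that by (simp add: r_def)
      finally show ?thesis using e(2) by auto
    qed
    define F where "F x u = h x u / u ^ Suc b" for x u
    have circ: "path_image (circlepath 0 r) = sphere 0 r" using r by simp
    have F_cont: "continuous_on (ball x0 r \<times> sphere 0 r) (\<lambda>(x, u). F x u)"
    proof -
      have "continuous_on (ball x0 r \<times> sphere 0 r) (\<lambda>p. (\<lambda>(x, y). h x y) p / snd p ^ Suc b)"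
        using r by (intro continuous_intros continuous_on_subset[OF h]) (auto simp: box)
      thus ?thesis by (simp add: F_def split_beta')
    qed
    define H where "H x = contour_integral (circlepath 0 r) (F x)" for x
    have H: "(deriv ^^ b) (\<lambda>y. h x y) 0 = fact b / (2 * pi * \<i>) * H x" if x: "x \<in> ball x0 r" for x
    proof -
      have "cball 0 r \<subseteq> {y. (x, y) \<in> W}" using x box by auto
      hence hol: "(\<lambda>y. h x y) holomorphic_on cball 0 r" using hy holomorphic_on_subset by blast
      have "contour_integral (circlepath 0 r) (\<lambda>u. h x u / (u - 0) ^ Suc b) = (2 * pi * \<i>) * (deriv ^^ b) (h x) 0 / fact b"
        using hol r by (intro Cauchy_contour_integral_circlepath)
          (auto intro: holomorphic_on_imp_continuous_on holomorphic_on_subset)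
      thus ?thesis by (simp add: H_def F_def[abs_def] field_simps)
    qed
    have H_cont: "continuous_on (ball x0 r) H"
    proof -
      have sph: "circlepath 0 r t \<in> sphere 0 r" for t
        using r by (simp add: circlepath norm_mult)
      have "continuous_on (ball x0 r \<times> cbox 0 (1::real)) (\<lambda>p. (\<lambda>(x, u). F x u) (fst p, circlepath 0 r (snd p)) * vector_derivative (circlepath 0 r) (at (snd p)))"
        unfolding vector_derivative_circlepath
        by (intro continuous_intros continuous_on_compose2[OF F_cont])
           (use sph in \<open>auto simp: circlepath intro!: continuous_intros\<close>)
      hence "continuous_on (ball x0 r \<times> cbox 0 (1::real)) (\<lambda>(x, t). F x (circlepath 0 r t) * vector_derivative (circlepath 0 r) (at t))"
        by (simp add: split_beta')
      from integral_continuous_on_param[OF this] show ?thesis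
        by (simp add: H_def[abs_def] contour_integral_integral)
    qed
    have "H analytic_on ball x0 r"
    proof (rule Morera_triangle[OF H_cont], simp, intro impI)
      fix a b' c assume abc: "convex hull {a, b', c} \<subseteq> ball x0 r"
      have seg: "closed_segment a b' \<subseteq> ball x0 r" "closed_segment b' c \<subseteq> ball x0 r" "closed_segment c a \<subseteq> ball x0 r"
        unfolding segment_convex_hull by (rule subset_trans[OF hull_mono abc], blast)+
      have swap: "contour_integral (linepath p q) H = contour_integral (circlepath 0 r) (\<lambda>u. contour_integral (linepath p q) (\<lambda>x. F x u))"
        if "closed_segment p q \<subseteq> ball x0 r" for p q
        unfolding H_def
      proof (rule contour_integral_swap)
        show "continuous_on (path_image (linepath p q) \<times> path_image (circlepath 0 r)) (\<lambda>(y1, y2). F y1 y2)"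
          using that r by (intro continuous_on_subset[OF F_cont]) (auto simp: circ)
      qed (auto simp: vector_derivative_circlepath intro!: continuous_intros)
      have ci: "(\<lambda>u. contour_integral (linepath p q) (\<lambda>x. F x u)) contour_integrable_on circlepath 0 r"
        if "closed_segment p q \<subseteq> ball x0 r" for p q
      proof (rule contour_integrable_continuous_circlepath)
        have "continuous_on (sphere 0 r \<times> cbox 0 (1::real)) (\<lambda>z. (\<lambda>(x, u). F x u) (linepath p q (snd z), fst z) * (q - p))"
          by (intro continuous_intros continuous_on_compose2[OF F_cont])
             (use that in \<open>auto simp: linepath_in_path subset_iff intro!: continuous_intros
                 continuous_on_compose2[OF continuous_on_linepath[of UNIV]]\<close>)
        hence "continuous_on (sphere 0 r \<times> cbox 0 (1::real)) (\<lambda>(u, t). F (linepath p q t) u * (q - p))"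
          by (simp add: split_beta')
        from integral_continuous_on_param[OF this]
        show "continuous_on (path_image (circlepath 0 r)) (\<lambda>u. contour_integral (linepath p q) (\<lambda>x. F x u))"
          using r by (simp add: circ contour_integral_integral)
      qed
      have tri: "contour_integral (linepath a b') (\<lambda>x. F x u) + contour_integral (linepath b' c) (\<lambda>x. F x u) + contour_integral (linepath c a) (\<lambda>x. F x u) = 0"
        if u: "u \<in> sphere 0 r" for u
      proof -
        have hol: "(\<lambda>x. F x u) holomorphic_on ball x0 r"
          unfolding F_def using u r box
          by (intro holomorphic_intros holomorphic_on_subset[OF hx]) auto
        have int: "(\<lambda>x. F x u) contour_integrable_on linepath p q" if "closed_segment p q \<subseteq> ball x0 r" for p q
          by (intro contour_integrable_continuous_linepath holomorphic_on_imp_continuous_on holomorphic_on_subset[OF hol that])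
        have "((\<lambda>x. F x u) has_contour_integral 0) (linepath a b' +++ linepath b' c +++ linepath c a)"
          by (rule Cauchy_theorem_triangle[OF holomorphic_on_subset[OF hol abc]])
        from contour_integral_unique[OF this] show ?thesis
          using int seg by (simp add: add.assoc)
      qed
      have "contour_integral (linepath a b') H + contour_integral (linepath b' c) H + contour_integral (linepath c a) H
        = contour_integral (circlepath 0 r) (\<lambda>u. contour_integral (linepath a b') (\<lambda>x. F x u) + contour_integral (linepath b' c) (\<lambda>x. F x u) + contour_integral (linepath c a) (\<lambda>x. F x u))"
        by (simp add: swap[OF seg(1)] swap[OF seg(2)] swap[OF seg(3)] contour_integral_add contour_integrable_add ci[OF seg(1)] ci[OF seg(2)] ci[OF seg(3)])
      also have "\<dots> = contour_integral (circlepath 0 r) (\<lambda>_. 0)"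
        by (rule contour_integral_cong) (use r in \<open>auto simp: circ tri\<close>)
      finally show "contour_integral (linepath a b') H + contour_integral (linepath b' c) H + contour_integral (linepath c a) H = 0"
        by simp
    qed
    hence "(\<lambda>x. fact b / (2 * pi * \<i>) * H x) holomorphic_on ball x0 r"
      by (intro holomorphic_intros analytic_imp_holomorphic)
    hence "(\<lambda>x. (deriv ^^ b) (\<lambda>y. h x y) 0) holomorphic_on ball x0 r"
      by (subst holomorphic_cong[OF refl H])
    with r show ?thesis by blast
  qed
  hence "(\<lambda>x. (deriv ^^ b) (\<lambda>y. h x y) 0) analytic_on V"
    unfolding analytic_on_def by (intro ballI)
  thus ?thesis by (rule analytic_imp_holomorphic)
qed

lemma norm_le_componentwise:
  fixes x y :: "complex ^ 'n::finite"
  assumes "\<And>i. cmod (x $ i) \<le> cmod (y $ i)"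
  shows "norm x \<le> norm y"
  unfolding norm_vec_def using assms by (intro L2_set_mono) auto

lemma Omega_hat_shrink:
  fixes u v :: "complex ^ (2 + 'm::finite)"
  assumes \<mu>: "\<mu> > 0" and v: "v \<in> Omega_hat \<mu>" and le: "\<And>i. cmod (u $ i) \<le> cmod (v $ i)"
  shows "u \<in> Omega_hat \<mu>"
proof -
  have b: "norm (base_part u) \<le> norm (base_part v)" and f: "norm (fibre_part u) \<le> norm (fibre_part v)"
    using le by (auto intro!: norm_le_componentwise)
  have v1: "norm (base_part v) < 1" using v by (simp add: Omega_hat_iff)
  have "(norm (fibre_part u))\<^sup>2 \<le> (norm (fibre_part v))\<^sup>2" using f by (intro power_mono) auto
  also have "\<dots> < (1 - (norm (base_part v))\<^sup>2) powr \<mu>" using v by (simp add: Omega_hat_iff)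
  also have "\<dots> \<le> (1 - (norm (base_part u))\<^sup>2) powr \<mu>"
    using b v1 \<mu> by (intro powr_mono2) (auto simp: power_le_one power_mono)
  finally show ?thesis using b v1 by (simp add: Omega_hat_iff)
qed

lemma Omega_hat_component_less_1:
  fixes v :: "complex ^ (2 + 'm::finite)"
  assumes \<mu>: "\<mu> > 0" and v: "v \<in> Omega_hat \<mu>"
  shows "cmod (v $ i) < 1"
proof (cases i)
  case (Inl k)
  have "cmod (base_part v $ k) \<le> norm (base_part v)" by (rule Finite_Cartesian_Product.norm_nth_le)
  thus ?thesis using v Inl by (simp add: Omega_hat_iff)
next
  case (Inr l)
  have "(norm (fibre_part v))\<^sup>2 < (1 - (norm (base_part v))\<^sup>2) powr \<mu>" using v by (simp add: Omega_hat_iff)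
  also have "\<dots> \<le> 1 powr \<mu>"
    using v \<mu> by (intro powr_mono2) (auto simp: Omega_hat_iff power_le_one)
  finally have "norm (fibre_part v) < 1" by (simp add: abs_square_less_1)
  moreover have "cmod (fibre_part v $ l) \<le> norm (fibre_part v)" by (rule Finite_Cartesian_Product.norm_nth_le)
  ultimately show ?thesis using Inr by simp
qed

lemma bounded_Omega_hat:
  assumes "\<mu> > 0"
  shows "bounded (Omega_hat \<mu> :: (complex ^ (2 + 'm::finite)) set)"
  unfolding bounded_iff
proof (intro exI ballI)
  fix v :: "complex ^ (2 + 'm)" assume v: "v \<in> Omega_hat \<mu>"
  have "norm v \<le> (\<Sum>i\<in>UNIV. cmod (v $ i))" unfolding norm_vec_def by (rule L2_set_le_sum) auto
  also have "\<dots> \<le> (\<Sum>i\<in>(UNIV :: (2 + 'm) set). 1)"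
    using Omega_hat_component_less_1[OF assms v] by (intro sum_mono) (simp add: less_imp_le)
  finally show "norm v \<le> real (CARD(2 + 'm))" by simp
qed

lemma zero_in_Omega_hat: "0 \<in> Omega_hat \<mu>"
proof -
  have "base_part (0 :: complex ^ (2 + 'a)) = 0" "fibre_part (0 :: complex ^ (2 + 'a)) = 0"
    by (simp_all add: vec_eq_iff)
  thus ?thesis by (simp add: Omega_hat_iff)
qed

lemma connected_Omega_hat:
  assumes "\<mu> > 0"
  shows "connected (Omega_hat \<mu> :: (complex ^ (2 + 'm::finite)) set)"
proof (rule starlike_imp_connected)
  show "starlike (Omega_hat \<mu> :: (complex ^ (2 + 'm)) set)"
    unfolding starlike_def
  proof (intro bexI[OF _ zero_in_Omega_hat] ballI subsetI)
    fix x y :: "complex ^ (2 + 'm)" assume x: "x \<in> Omega_hat \<mu>" and "y \<in> closed_segment 0 x"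
    then obtain u where u: "0 \<le> u" "u \<le> 1" "y = u *\<^sub>R x" by (auto simp: in_segment)
    show "y \<in> Omega_hat \<mu>"
      using u by (intro Omega_hat_shrink[OF assms x]) (simp add: mult_left_le_one_le)
  qed
qed

text \<open>The points to which unitary symmetry reduces the second argument of the kernel; the base coordinate
\<open>1\<close> is an arbitrary choice.\<close>

definition axis_point :: "'m \<Rightarrow> complex \<Rightarrow> complex \<Rightarrow> complex ^ (2 + 'm::finite)" where
  "axis_point j x y = (\<chi> i. if i = Inl 1 then x else if i = Inr j then y else 0)"

lemma axis_point_nth [simp]:
  "axis_point j x y $ i = (if i = Inl 1 then x else if i = Inr j then y else 0)"
  by (simp add: axis_point_def)

lemma norm_axis_complex: "norm (axis i x :: complex ^ 'n::finite) = cmod x"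
proof -
  have "norm (axis i x :: complex ^ 'n) = sqrt (\<Sum>k\<in>UNIV. if k = i then (cmod x)\<^sup>2 else 0)"
    unfolding norm_vec_def L2_set_def axis_def by (intro arg_cong[of _ _ sqrt] sum.cong) auto
  thus ?thesis by simp
qed

lemma axis_point_in_Omega_hat:
  "axis_point j x y \<in> Omega_hat \<mu> \<longleftrightarrow> cmod x < 1 \<and> (cmod y)\<^sup>2 < (1 - (cmod x)\<^sup>2) powr \<mu>"
proof -
  have "base_part (axis_point j x y) = axis 1 x" "fibre_part (axis_point j x y) = axis j y"
    by (auto simp: vec_eq_iff axis_def)
  thus ?thesis by (simp add: Omega_hat_iff norm_axis_complex)
qed

lemma bergman_space_imp_integrable:
  fixes U :: "(complex ^ 'n::finite) set"
  assumes f: "f \<in> bergman_space U" and U: "open U" "bounded U"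
  shows "set_integrable lborel U f"
proof -
  have hol: "holomorphic_several f U" and sq: "set_integrable lborel U (\<lambda>z. (cmod (f z))\<^sup>2)"
    using f by (auto simp: bergman_space_def)
  have [measurable]: "U \<in> sets borel" using U by simp
  have "set_integrable lborel U (\<lambda>_. 1 :: real)"
    using emeasure_bounded_finite[OF U(2)] by (simp add: set_integrable_def)
  with sq have "set_integrable lborel U (\<lambda>z. (cmod (f z))\<^sup>2 + 1)" by (rule set_integral_add)
  thus ?thesis
  proof (rule set_integrable_bound)
    show "set_borel_measurable lborel U f"
      unfolding set_borel_measurable_def
      using borel_measurable_continuous_on_indicator[OF _ holomorphic_several_imp_continuous_on[OF hol]] by simp
    have "cmod (f x) \<le> norm ((cmod (f x))\<^sup>2 + 1)" for x
    proof -
      have "0 \<le> (cmod (f x) - 1)\<^sup>2" by simp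
      hence "2 * cmod (f x) \<le> (cmod (f x))\<^sup>2 + 1" by (simp add: power2_eq_square algebra_simps)
      moreover have "0 \<le> cmod (f x)" by simp
      ultimately have "cmod (f x) \<le> (cmod (f x))\<^sup>2 + 1" by linarith
      thus ?thesis by simp
    qed
    thus "AE x in lborel. x \<in> U \<longrightarrow> cmod (f x) \<le> norm ((cmod (f x))\<^sup>2 + 1)" by simp
  qed
qed

text \<open>Every function of the Bergman space has coefficients \<open>c a b\<close> that serve both as Fourier
coefficients with respect to the monomials in the two distinguished coordinates and as Taylor
coefficients on the plane of axis points. The expansion is stated as an iterated sum, first in \<open>x\<close>
and then in \<open>y\<close>, so that only power series in one variable occur.\<close>

lemma monomial_coefficients:
  fixes j :: "'m::finite"
  assumes \<mu>: "\<mu> > 0" and f: "f \<in> bergman_space (Omega_hat \<mu> :: (complex ^ (2 + 'm)) set)"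
  obtains c :: "nat \<Rightarrow> nat \<Rightarrow> complex" where
    "\<And>a b. (LINT v:Omega_hat \<mu>|lborel. f v * cnj (v $ Inl 1 ^ a * v $ Inr j ^ b))
        = c a b * (LINT v:Omega_hat \<mu>|lborel. (v $ Inl 1 ^ a * v $ Inr j ^ b) * cnj (v $ Inl 1 ^ a * v $ Inr j ^ b))"
    "\<And>x y. axis_point j x y \<in> Omega_hat \<mu> \<Longrightarrow>
        \<exists>g. (\<forall>b. (\<lambda>a. c a b * x ^ a) sums g b) \<and> (\<lambda>b. g b * y ^ b) sums f (axis_point j x y)"
proof -
  let ?D = "Omega_hat \<mu> :: (complex ^ (2 + 'm)) set"
  note oD = open_Omega_hat[of \<mu>, where 'm = 'm]
  have Dm: "?D \<in> sets lborel" using oD by simp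
  have hol: "holomorphic_several f ?D" using f by (simp add: bergman_space_def)
  have fc: "continuous_on ?D f" by (rule holomorphic_several_imp_continuous_on[OF hol])
  have fi: "set_integrable lborel ?D f" by (rule bergman_space_imp_integrable[OF f oD bounded_Omega_hat[OF \<mu>]])
  have sc: "scale_coords S s v \<in> ?D" if "v \<in> ?D" "cmod s \<le> 1" for S s and v :: "complex ^ (2 + 'm)"
    by (rule Omega_hat_shrink[OF \<mu> that(1)]) (use that in \<open>auto simp: norm_mult mult_left_le_one_le\<close>)
  have sc_line: "scale_coords S s v = (\<chi> i. if i \<in> S then 0 else v $ i) + s *s (\<chi> i. if i \<in> S then v $ i else 0)"
    for S s and v :: "complex ^ (2 + 'm)" by (simp add: vec_eq_iff)
  define h where "h x y = f (axis_point j x y)" for x y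
  define hb where "hb b x = (deriv ^^ b) (\<lambda>y. h x y) 0 / fact b" for b x
  define c where "c a b = (deriv ^^ a) (hb b) 0 / fact a" for a b
  have proj: "axis_point j (v $ Inl 1) (v $ Inr j) \<in> ?D" if "v \<in> ?D" for v :: "complex ^ (2 + 'm)"
    by (rule Omega_hat_shrink[OF \<mu> that]) auto
  have ap_cont: "continuous_on S (\<lambda>z. axis_point j (g1 z) (g2 z))" if "continuous_on S g1" "continuous_on S g2"
    for S :: "'z::topological_space set" and g1 g2
    unfolding axis_point_def
  proof (rule continuous_on_vec_lambda)
    fix i show "continuous_on S (\<lambda>z. if i = Inl 1 then g1 z else if i = Inr j then g2 z else 0)"
      using that by (cases "i = Inl 1"; cases "i = Inr j") auto
  qed
  let ?W = "{(x, y). axis_point j x y \<in> ?D}"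
  have "open ((\<lambda>z. axis_point j (fst z) (snd z)) -` ?D)"
    by (intro open_vimage[OF oD] ap_cont continuous_intros)
  hence oW: "open ?W" by (simp add: vimage_def split_beta')
  have hc: "continuous_on ?W (\<lambda>(x, y). h x y)"
    unfolding h_def split_beta' by (intro continuous_on_compose2[OF fc] ap_cont continuous_intros) auto
  have hx: "(\<lambda>x. h x y) holomorphic_on {x. axis_point j x y \<in> ?D}" for y
    unfolding h_def by (rule holomorphic_several_on_line[OF hol, where c = "axis_point j 0 y" and u = "axis_point j 1 0"])
      (auto simp: vec_eq_iff)
  have hy: "(\<lambda>y. h x y) holomorphic_on {y. axis_point j x y \<in> ?D}" for x
    unfolding h_def by (rule holomorphic_several_on_line[OF hol, where c = "axis_point j x 0" and u = "axis_point j 0 1"])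
      (auto simp: vec_eq_iff)
  have oy: "open {y. axis_point j x y \<in> ?D}" for x
  proof -
    have "open ((\<lambda>y. axis_point j x y) -` ?D)" by (intro open_vimage[OF oD] ap_cont continuous_intros)
    thus ?thesis by (simp add: vimage_def)
  qed
  have hb: "hb b holomorphic_on ball 0 1" for b
  proof -
    have "(\<lambda>x. (deriv ^^ b) (\<lambda>y. h x y) 0) holomorphic_on ball 0 1"
      by (rule holomorphic_taylor_coefficient_in_parameter[OF oW hc])
         (use hx hy in \<open>auto simp: axis_point_in_Omega_hat abs_square_eq_1\<close>)
    thus ?thesis unfolding hb_def[abs_def] by (intro holomorphic_intros) auto
  qed
  have x1: "cmod (v $ Inl 1) < 1" if "v \<in> ?D" for v :: "complex ^ (2 + 'm)"
    by (rule Omega_hat_component_less_1[OF \<mu> that])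

  show ?thesis
  proof (rule that[of c])
    fix a b
    let ?p = "\<lambda>v :: complex ^ (2 + 'm). v $ Inl 1 ^ a * v $ Inr j ^ b"
    have pm: "?p \<in> borel_measurable borel" by measurable
    have pB: "cmod (?p v) \<le> 1" if "v \<in> ?D" for v :: "complex ^ (2 + 'm)"
      using Omega_hat_component_less_1[OF \<mu> that] by (simp add: norm_mult norm_power mult_le_one power_le_one less_imp_le)
    \<comment> \<open>rotating all other coordinates, on which the monomial does not depend, evaluates \<open>f\<close> where they vanish\<close>
    let ?S1 = "- {Inl 1, Inr j} :: (2 + 'm) set"
    have F1: "(deriv ^^ 0) (\<lambda>s. f (scale_coords ?S1 s v)) 0 / fact 0 = h (v $ Inl 1) (v $ Inr j)" for v :: "complex ^ (2 + 'm)"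
      by (simp add: h_def) (rule arg_cong[of _ _ f], auto simp: vec_eq_iff)
    have hol1: "(\<lambda>s. f (scale_coords ?S1 s v)) holomorphic_on {s. scale_coords ?S1 s v \<in> ?D}" if "v \<in> ?D" for v :: "complex ^ (2 + 'm)"
      by (rule holomorphic_several_on_line[OF hol _ sc_line]) simp
    note st1 = circle_average[OF oD sc fc fi hol1 pm pB, where n = 0, unfolded F1]
    have i1: "set_integrable lborel ?D (\<lambda>v. h (v $ Inl 1) (v $ Inr j))"
      and e1: "(LINT v:?D|lborel. f v * cnj (?p v)) = (LINT v:?D|lborel. h (v $ Inl 1) (v $ Inr j) * cnj (?p v))"
      by (rule st1; simp)+
    \<comment> \<open>rotating \<open>y\<close> extracts the term of degree \<open>b\<close> in \<open>y\<close>\<close>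
    let ?S2 = "{Inr j} :: (2 + 'm) set"
    have c1: "continuous_on ?D (\<lambda>v. h (v $ Inl 1) (v $ Inr j))"
      unfolding h_def by (intro continuous_on_compose2[OF fc] ap_cont continuous_intros) (auto intro: proj)
    have hol2: "(\<lambda>s. h (scale_coords ?S2 s v $ Inl 1) (scale_coords ?S2 s v $ Inr j)) holomorphic_on {s. scale_coords ?S2 s v \<in> ?D}" for v :: "complex ^ (2 + 'm)"
    proof -
      have "(\<lambda>s. h (v $ Inl 1) (s * v $ Inr j)) holomorphic_on {s. scale_coords ?S2 s v \<in> ?D}"
      proof (rule holomorphic_on_compose_gen[OF _ hy, unfolded o_def])
        show "(\<lambda>s. s * v $ Inr j) ` {s. scale_coords ?S2 s v \<in> ?D} \<subseteq> {y. axis_point j (v $ Inl 1) y \<in> ?D}"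
          using proj by fastforce
      qed (intro holomorphic_intros)
      thus ?thesis by simp
    qed
    have F2: "(deriv ^^ b) (\<lambda>s. h (scale_coords ?S2 s v $ Inl 1) (scale_coords ?S2 s v $ Inr j)) 0 / fact b
        = v $ Inr j ^ b * hb b (v $ Inl 1)" if "v \<in> ?D" for v :: "complex ^ (2 + 'm)"
    proof -
      let ?T = "{y. axis_point j (v $ Inl 1) y \<in> ?D}"
      have "open ((\<lambda>s. v $ Inr j * s) -` ?T)" by (intro open_vimage oy continuous_intros)
      hence "(deriv ^^ b) (\<lambda>s. h (v $ Inl 1) (v $ Inr j * s)) 0 = v $ Inr j ^ b * (deriv ^^ b) (h (v $ Inl 1)) (v $ Inr j * 0)"
        using x1[OF that] by (intro higher_deriv_compose_linear[OF hy _ oy, where S = "(\<lambda>s. v $ Inr j * s) -` ?T"])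
          (auto simp: axis_point_in_Omega_hat abs_square_eq_1)
      thus ?thesis by (simp add: hb_def mult.commute)
    qed
    note st2 = circle_average[OF oD sc c1 i1 hol2 pm pB, where n = b]
    have i2: "set_integrable lborel ?D (\<lambda>v. v $ Inr j ^ b * hb b (v $ Inl 1))"
    proof -
      have "set_integrable lborel ?D (\<lambda>v. (deriv ^^ b) (\<lambda>s. h (scale_coords ?S2 s v $ Inl 1) (scale_coords ?S2 s v $ Inr j)) 0 / fact b)"
        by (rule st2(1)) (simp_all add: power_mult_distrib)
      thus ?thesis by (subst (asm) set_integrable_cong[OF refl refl F2])
    qed
    have e2: "(LINT v:?D|lborel. h (v $ Inl 1) (v $ Inr j) * cnj (?p v)) = (LINT v:?D|lborel. v $ Inr j ^ b * hb b (v $ Inl 1) * cnj (?p v))"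
    proof -
      have "(LINT v:?D|lborel. h (v $ Inl 1) (v $ Inr j) * cnj (?p v))
          = (LINT v:?D|lborel. (deriv ^^ b) (\<lambda>s. h (scale_coords ?S2 s v $ Inl 1) (scale_coords ?S2 s v $ Inr j)) 0 / fact b * cnj (?p v))"
        by (rule st2(2)) (simp_all add: power_mult_distrib)
      also have "\<dots> = (LINT v:?D|lborel. v $ Inr j ^ b * hb b (v $ Inl 1) * cnj (?p v))"
        using Dm by (rule set_lebesgue_integral_cong) (intro allI impI, simp only: F2)
      finally show ?thesis .
    qed
    \<comment> \<open>rotating \<open>x\<close> extracts the term of degree \<open>a\<close> in \<open>x\<close>\<close>
    let ?S3 = "{Inl 1} :: (2 + 'm) set"
    have c2: "continuous_on ?D (\<lambda>v. v $ Inr j ^ b * hb b (v $ Inl 1))"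
      by (intro continuous_intros continuous_on_compose2[OF holomorphic_on_imp_continuous_on[OF hb]])
         (auto intro: x1)
    have hol3: "(\<lambda>s. scale_coords ?S3 s v $ Inr j ^ b * hb b (scale_coords ?S3 s v $ Inl 1)) holomorphic_on {s. scale_coords ?S3 s v \<in> ?D}" for v :: "complex ^ (2 + 'm)"
    proof -
      have "(\<lambda>s. hb b (s * v $ Inl 1)) holomorphic_on {s. scale_coords ?S3 s v \<in> ?D}"
      proof (rule holomorphic_on_compose_gen[OF _ hb, unfolded o_def])
        show "(\<lambda>s. s * v $ Inl 1) ` {s. scale_coords ?S3 s v \<in> ?D} \<subseteq> ball 0 1"
          using x1 by fastforce
      qed (intro holomorphic_intros)
      thus ?thesis by (auto intro!: holomorphic_intros)
    qed
    have F3: "(deriv ^^ a) (\<lambda>s. scale_coords ?S3 s v $ Inr j ^ b * hb b (scale_coords ?S3 s v $ Inl 1)) 0 / fact a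
        = c a b * ?p v" if "v \<in> ?D" for v :: "complex ^ (2 + 'm)"
    proof -
      let ?S = "(\<lambda>s. v $ Inl 1 * s) -` ball 0 1"
      have S: "open ?S" by (intro open_vimage continuous_intros) auto
      have "(\<lambda>s. hb b (v $ Inl 1 * s)) holomorphic_on ?S"
        by (rule holomorphic_on_compose_gen[OF _ hb, unfolded o_def]) (auto intro!: holomorphic_intros)
      hence "(deriv ^^ a) (\<lambda>s. v $ Inr j ^ b * hb b (v $ Inl 1 * s)) 0 = v $ Inr j ^ b * (deriv ^^ a) (\<lambda>s. hb b (v $ Inl 1 * s)) 0"
        by (rule higher_deriv_cmult[OF _ _ S]) simp
      also have "(deriv ^^ a) (\<lambda>s. hb b (v $ Inl 1 * s)) 0 = v $ Inl 1 ^ a * (deriv ^^ a) (hb b) (v $ Inl 1 * 0)"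
        by (rule higher_deriv_compose_linear[OF hb S]) auto
      finally show ?thesis by (simp add: c_def mult_ac)
    qed
    note st3 = circle_average(2)[OF oD sc c2 i2 hol3 pm pB, where n = a]
    have e3: "(LINT v:?D|lborel. v $ Inr j ^ b * hb b (v $ Inl 1) * cnj (?p v)) = (LINT v:?D|lborel. c a b * ?p v * cnj (?p v))"
    proof -
      have "(LINT v:?D|lborel. v $ Inr j ^ b * hb b (v $ Inl 1) * cnj (?p v))
          = (LINT v:?D|lborel. (deriv ^^ a) (\<lambda>s. scale_coords ?S3 s v $ Inr j ^ b * hb b (scale_coords ?S3 s v $ Inl 1)) 0 / fact a * cnj (?p v))"
        by (rule st3) (simp_all add: power_mult_distrib)
      also have "\<dots> = (LINT v:?D|lborel. c a b * ?p v * cnj (?p v))"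
        using Dm by (rule set_lebesgue_integral_cong) (intro allI impI, simp only: F3)
      finally show ?thesis .
    qed
    show "(LINT v:?D|lborel. f v * cnj (?p v)) = c a b * (LINT v:?D|lborel. ?p v * cnj (?p v))"
      unfolding e1 e2 e3 by (simp add: set_lebesgue_integral_def mult.assoc scaleR_conv_of_real mult.left_commute[of "of_real _"])
  next
    fix x y assume "axis_point j x y \<in> ?D"
    hence xy: "cmod x < 1" "(cmod y)\<^sup>2 < (1 - (cmod x)\<^sup>2) powr \<mu>" by (auto simp: axis_point_in_Omega_hat)
    show "\<exists>g. (\<forall>b. (\<lambda>a. c a b * x ^ a) sums g b) \<and> (\<lambda>b. g b * y ^ b) sums f (axis_point j x y)"
    proof (intro exI[of _ "\<lambda>b. hb b x"] conjI allI)
      show "(\<lambda>a. c a b * x ^ a) sums hb b x" for b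
        using holomorphic_power_series[OF hb, of x b] xy by (simp add: c_def)
      define r where "r = sqrt ((1 - (cmod x)\<^sup>2) powr \<mu>)"
      have r2: "r\<^sup>2 = (1 - (cmod x)\<^sup>2) powr \<mu>" "r \<ge> 0" by (auto simp: r_def)
      have r: "cmod z < r \<longleftrightarrow> axis_point j x z \<in> ?D" for z
        using xy r2 by (auto simp: axis_point_in_Omega_hat intro: power_strict_mono power2_less_imp_less)
           (metis norm_ge_zero power_strict_mono pos2)
      have "(\<lambda>z. h x z) holomorphic_on ball 0 r"
        by (rule holomorphic_on_subset[OF hy]) (auto simp: r)
      from holomorphic_power_series[OF this, of y] show "(\<lambda>b. hb b x * y ^ b) sums f (axis_point j x y)"
        using xy by (simp add: hb_def h_def r axis_point_in_Omega_hat)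
    qed
  qed
qed

section \<open>The kernel series\<close>

lemma sums_one_minus_powr:
  fixes t \<sigma> :: complex
  assumes "cmod t < 1"
  shows "(\<lambda>a. pochhammer \<sigma> a / fact a * t ^ a) sums (1 - t) powr (- \<sigma>)"
proof -
  have "(\<lambda>n. ((- \<sigma>) gchoose n) * (- t) ^ n) sums (1 + (- t)) powr (- \<sigma>)"
    by (rule gen_binomial_complex) (use assms in simp)
  moreover have "((- \<sigma>) gchoose n) * (- t) ^ n = pochhammer \<sigma> n / fact n * t ^ n" for n
  proof -
    have "(-1) ^ n * (- t) ^ n = t ^ n" by (simp flip: power_mult_distrib)
    thus ?thesis by (simp add: gbinomial_pochhammer mult_ac)
  qed
  ultimately show ?thesis by simp
qed

lemma sums_fact_quotient:
  fixes x :: complex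
  assumes "cmod x < 1"
  shows "(\<lambda>b. fact (b + n) / fact b * x ^ b) sums (fact n / (1 - x) ^ (n + 1))"
proof -
  have s: "(\<lambda>b. fact n * (pochhammer (of_nat (n + 1)) b / fact b * x ^ b)) sums (fact n * (1 - x) powr (- of_nat (n + 1)))"
    by (intro sums_mult sums_one_minus_powr assms)
  have "fact n * pochhammer (of_nat (n + 1)) b = (fact (b + n) :: complex)" for b
    using pochhammer_product'[of "1::complex" n b] by (simp add: pochhammer_fact add.commute)
  hence e1: "fact n * (pochhammer (of_nat (n + 1)) b / fact b * x ^ b) = fact (b + n) / fact b * x ^ b" for b
    by simp
  have e2: "(1 - x) powr (- of_nat (n + 1)) = 1 / (1 - x) ^ (n + 1)"
  proof -
    have "1 - x \<noteq> 0" using assms by auto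
    thus ?thesis by (subst powr_minus, subst powr_nat') (auto simp: divide_inverse)
  qed
  show ?thesis using s unfolding e1 e2 by (simp only: mult_1_right times_divide_eq_right)
qed

text \<open>The reciprocal of the squared norm of \<open>y\<^sup>b\<close>, up to a constant.\<close>

definition kernel_coeff :: "real \<Rightarrow> nat \<Rightarrow> nat \<Rightarrow> real" where
  "kernel_coeff \<mu> m b = fact (b + m) / fact b * ((\<mu> * (b + m) + 1) * (\<mu> * (b + m) + 2))"

text \<open>The polynomial \<open>q\<close> with \<open>\<Sum>b. kernel_coeff \<mu> m b * x\<^sup>b = m! * q(x) / (1 - x)\<^bsup>m + 3\<^esup>\<close>. Powers of
\<open>1 - x\<close> are the natural form: they correspond to the expansion of the quadratic factor of
\<open>kernel_coeff\<close> in rising factorials of \<open>b + m + 1\<close>.\<close>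

definition kernel_quadratic :: "real \<Rightarrow> nat \<Rightarrow> complex \<Rightarrow> complex" where
  "kernel_quadratic \<mu> m x = of_real (\<mu>\<^sup>2 * (m + 1) * (m + 2)) + of_real (3 * \<mu> * (1 - \<mu>) * (m + 1)) * (1 - x)
      + of_real ((1 - \<mu>) * (2 - \<mu>)) * (1 - x)\<^sup>2"

lemma kernel_coeff_nonneg: "\<mu> > 0 \<Longrightarrow> kernel_coeff \<mu> m b \<ge> 0"
  by (simp add: kernel_coeff_def)

lemma kernel_coeff_sums:
  fixes x :: complex
  assumes x: "cmod x < 1"
  shows "(\<lambda>b. of_real (kernel_coeff \<mu> m b) * x ^ b) sums (fact m * kernel_quadratic \<mu> m x / (1 - x) ^ (m + 3))"
proof -
  have x1: "1 - x \<noteq> 0" using x by auto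
  let ?A = "of_real (\<mu>\<^sup>2) :: complex" and ?B = "of_real (3 * \<mu> * (1 - \<mu>)) :: complex" and ?C = "of_real ((1 - \<mu>) * (2 - \<mu>)) :: complex"
  have "(\<lambda>b. ?A * (fact (b + (m + 2)) / fact b * x ^ b) + ?B * (fact (b + (m + 1)) / fact b * x ^ b) + ?C * (fact (b + m) / fact b * x ^ b))
     sums (?A * (fact (m + 2) / (1 - x) ^ (m + 2 + 1)) + ?B * (fact (m + 1) / (1 - x) ^ (m + 1 + 1)) + ?C * (fact m / (1 - x) ^ (m + 1)))"
    by (intro sums_add sums_mult sums_fact_quotient x)
  moreover have "?A * (fact (b + (m + 2)) / fact b * x ^ b) + ?B * (fact (b + (m + 1)) / fact b * x ^ b) + ?C * (fact (b + m) / fact b * x ^ b)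
     = of_real (kernel_coeff \<mu> m b) * x ^ b" for b
  proof -
    have "\<mu>\<^sup>2 * (N + 1) * (N + 2) + 3 * \<mu> * (1 - \<mu>) * (N + 1) + (1 - \<mu>) * (2 - \<mu>) = (\<mu> * N + 1) * (\<mu> * N + 2)" for N :: real
      by (simp add: power2_eq_square algebra_simps)
    from this[of "real (b + m)"]
    have "kernel_coeff \<mu> m b = fact (b + m) / fact b * (\<mu>\<^sup>2 * (real (b + m) + 1) * (real (b + m) + 2) + 3 * \<mu> * (1 - \<mu>) * (real (b + m) + 1) + (1 - \<mu>) * (2 - \<mu>))"
      by (simp add: kernel_coeff_def)
    also have "\<dots> = \<mu>\<^sup>2 * (fact (b + (m + 2)) / fact b) + 3 * \<mu> * (1 - \<mu>) * (fact (b + (m + 1)) / fact b) + (1 - \<mu>) * (2 - \<mu>) * (fact (b + m) / fact b)"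
      by (simp add: field_simps)
    finally show ?thesis
      by (simp only: of_real_add of_real_mult of_real_divide of_real_fact distrib_right mult.assoc)
  qed
  moreover have "?A * (fact (m + 2) / (1 - x) ^ (m + 2 + 1)) + ?B * (fact (m + 1) / (1 - x) ^ (m + 1 + 1)) + ?C * (fact m / (1 - x) ^ (m + 1))
     = fact m * kernel_quadratic \<mu> m x / (1 - x) ^ (m + 3)"
  proof -
    define y where "y = 1 - x"
    have y: "y \<noteq> 0" using x1 by (simp add: y_def)
    have q: "kernel_quadratic \<mu> m x = ?A * (of_nat m + 1) * (of_nat m + 2) + ?B * (of_nat m + 1) * y + ?C * y\<^sup>2"
      by (simp add: kernel_quadratic_def y_def add.commute)
    have alg: "A * (F * (M + 1) * (M + 2) / (P * y\<^sup>2)) + B * (F * (M + 1) / (P * y)) + C * (F / P)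
        = F * (A * (M + 1) * (M + 2) + B * (M + 1) * y + C * y\<^sup>2) / (P * y\<^sup>2)"
      if "P \<noteq> 0" for A B C F M P :: complex
      using that y by (simp add: field_simps power2_eq_square)
    define P where "P = y ^ (m + 1)"
    have "P \<noteq> 0" using y by (simp add: P_def)
    have pw: "y ^ (m + 3) = P * y\<^sup>2" "y ^ (m + 2 + 1) = P * y\<^sup>2" "y ^ (m + 1 + 1) = P * y" "y ^ (m + 1) = P"
      by (simp_all add: P_def power_add power2_eq_square power3_eq_cube)
    have fs: "fact (m + 2) = (fact m * (of_nat m + 1) * (of_nat m + 2) :: complex)" "fact (m + 1) = (fact m * (of_nat m + 1) :: complex)"
      by (simp_all add: algebra_simps)
    show ?thesis unfolding q y_def[symmetric] pw fs by (rule alg) fact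
  qed
  ultimately show ?thesis by simp
qed

lemma kernel_coeff_summable:
  assumes "0 \<le> q" "q < 1" 
  shows "summable (\<lambda>b. kernel_coeff \<mu> m b * q ^ b)"
proof -
  have "summable (\<lambda>b. of_real (kernel_coeff \<mu> m b) * of_real q ^ b :: complex)"
    using kernel_coeff_sums[of "of_real q" \<mu> m] assms by (simp add: sums_iff)
  hence "summable (\<lambda>b. complex_of_real (kernel_coeff \<mu> m b * q ^ b))" by simp
  thus ?thesis by (simp only: summable_of_real_iff)
qed

lemma cmod_powr_of_real: "z \<noteq> 0 \<Longrightarrow> cmod (z powr of_real a) = cmod z powr a"
  by (simp add: powr_def)

text \<open>Termwise integration against an integrable function, justified by a summable uniform bound.\<close>

lemma set_integral_mult_cnj_sums:
  fixes f G :: "'a::euclidean_space \<Rightarrow> complex" and g :: "nat \<Rightarrow> 'a \<Rightarrow> complex"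
  assumes U: "open U" and f: "set_integrable lborel U f"
    and g: "\<And>n. continuous_on U (g n)" "\<And>n v. v \<in> U \<Longrightarrow> cmod (g n v) \<le> B n"
    and B: "summable B" and G: "\<And>v. v \<in> U \<Longrightarrow> (\<lambda>n. g n v) sums G v"
  shows "(\<lambda>n. LINT v:U|lborel. f v * cnj (g n v)) sums (LINT v:U|lborel. f v * cnj (G v))"
proof -
  have [measurable]: "U \<in> sets borel" using U by simp
  let ?h = "\<lambda>n v. indicator U v *\<^sub>R (f v * cnj (g n v))"
  have fi: "integrable lborel (\<lambda>v. indicator U v *\<^sub>R f v)" using f by (simp add: set_integrable_def)
  have gm: "(\<lambda>v. indicator U v *\<^sub>R cnj (g n v)) \<in> borel_measurable borel" for n
    by (intro borel_measurable_continuous_on_indicator continuous_on_cnj g) simp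
  have fm: "(\<lambda>v. indicator U v *\<^sub>R f v) \<in> borel_measurable borel" using fi by simp
  have hm: "?h n \<in> borel_measurable borel" for n
  proof -
    have "(\<lambda>v. (indicator U v *\<^sub>R f v) * (indicator U v *\<^sub>R cnj (g n v))) \<in> borel_measurable borel"
      using fm gm[of n] by (rule borel_measurable_times)
    also have "(\<lambda>v. (indicator U v *\<^sub>R f v) * (indicator U v *\<^sub>R cnj (g n v))) = ?h n"
      by (auto simp: indicator_def fun_eq_iff)
    finally show ?thesis .
  qed
  have le: "norm (?h n v) \<le> B n * norm (indicator U v *\<^sub>R f v)" for n v
    using g(2)[of v n] by (auto simp: indicator_def norm_mult mult.commute[of "cmod (f v)"] intro!: mult_right_mono)
  have hi: "integrable lborel (?h n)" for n
  proof (rule Bochner_Integration.integrable_bound)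
    show "integrable lborel (\<lambda>v. B n *\<^sub>R (indicator U v *\<^sub>R f v))" using fi by (rule integrable_scaleR_right)
    show "AE v in lborel. norm (?h n v) \<le> norm (B n *\<^sub>R (indicator U v *\<^sub>R f v))"
    proof (rule AE_I2)
      fix v
      have "norm (?h n v) \<le> B n * norm (indicator U v *\<^sub>R f v)" by (rule le)
      also have "\<dots> \<le> \<bar>B n\<bar> * norm (indicator U v *\<^sub>R f v)" by (intro mult_right_mono) auto
      finally show "norm (?h n v) \<le> norm (B n *\<^sub>R (indicator U v *\<^sub>R f v))"
        by (simp only: norm_scaleR)
    qed
  qed (use hm in simp)
  have "(\<lambda>n. integral\<^sup>L lborel (?h n)) sums (\<integral>v. (\<Sum>n. ?h n v) \<partial>lborel)"
  proof (rule sums_integral[OF hi])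
    show "AE v in lborel. summable (\<lambda>n. norm (?h n v))"
      by (rule AE_I2, rule summable_comparison_test'[where N = 0, OF summable_mult2[OF B]]) (use le in simp)
    have "norm (\<integral>v. norm (?h n v) \<partial>lborel) \<le> B n * (\<integral>v. norm (indicator U v *\<^sub>R f v) \<partial>lborel)" for n
    proof -
      have "(\<integral>v. norm (?h n v) \<partial>lborel) \<le> (\<integral>v. B n * norm (indicator U v *\<^sub>R f v) \<partial>lborel)"
        by (intro integral_mono le integrable_norm hi integrable_mult_right fi)
      thus ?thesis by simp
    qed
    thus "summable (\<lambda>n. \<integral>v. norm (?h n v) \<partial>lborel)"
      by (intro summable_comparison_test'[where N = 0, OF summable_mult2[OF B]])
  qed
  also have "(\<lambda>v. \<Sum>n. ?h n v) = (\<lambda>v. indicator U v *\<^sub>R (f v * cnj (G v)))"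
  proof
    fix v show "(\<Sum>n. ?h n v) = indicator U v *\<^sub>R (f v * cnj (G v))"
    proof (cases "v \<in> U")
      case True
      have "(\<lambda>n. f v * cnj (g n v)) sums (f v * cnj (G v))"
        by (intro sums_mult) (use G[OF True] in \<open>simp add: sums_cnj\<close>)
      thus ?thesis using True by (simp add: sums_iff)
    qed simp
  qed
  finally show ?thesis by (simp add: set_lebesgue_integral_def)
qed

lemma holomorphic_several_nth:
  fixes U :: "(complex ^ 'n::finite) set"
  shows "holomorphic_several (\<lambda>v. v $ i) U"
  unfolding holomorphic_several_def
proof
  fix z :: "complex ^ 'n"
  have "((\<lambda>v. v $ i) has_derivative (\<lambda>v. v $ i)) (at z :: (complex ^ 'n) filter)"
    by (intro bounded_linear_imp_has_derivative bounded_linear_vec_nth)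
  thus "\<exists>f'. ((\<lambda>v. v $ i) has_derivative f') (at z) \<and> (\<forall>c v. f' (c *s v) = c * f' v)"
    by auto
qed

lemma holomorphic_several_mult:
  assumes "holomorphic_several f U" "holomorphic_several g U"
  shows "holomorphic_several (\<lambda>v. f v * g v) U"
  unfolding holomorphic_several_def
proof
  fix z assume "z \<in> U"
  then obtain f' g' where f: "(f has_derivative f') (at z)" "\<And>c v. f' (c *s v) = c * f' v"
    and g: "(g has_derivative g') (at z)" "\<And>c v. g' (c *s v) = c * g' v"
    using assms unfolding holomorphic_several_def by meson
  from has_derivative_mult[OF f(1) g(1)]
  show "\<exists>f'. ((\<lambda>v. f v * g v) has_derivative f') (at z) \<and> (\<forall>c v. f' (c *s v) = c * f' v)"
    by (intro exI[of _ "\<lambda>h. f z * g' h + f' h * g z"]) (auto simp: f(2) g(2) algebra_simps)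
qed

lemma holomorphic_several_compose:
  assumes f: "holomorphic_several f U" and g: "g holomorphic_on V" "open V" and V: "\<And>v. v \<in> U \<Longrightarrow> f v \<in> V"
  shows "holomorphic_several (\<lambda>v. g (f v)) U"
  unfolding holomorphic_several_def
proof
  fix z assume z: "z \<in> U"
  then obtain f' where f': "(f has_derivative f') (at z)" "\<And>c v. f' (c *s v) = c * f' v"
    using f unfolding holomorphic_several_def by meson
  have "(g has_field_derivative deriv g (f z)) (at (f z))"
    using g V[OF z] by (rule holomorphic_derivI)
  hence "(g has_derivative (\<lambda>h. deriv g (f z) * h)) (at (f z))" by (simp add: has_field_derivative_def)
  from diff_chain_at[OF f'(1) this]
  show "\<exists>f'. ((\<lambda>v. g (f v)) has_derivative f') (at z) \<and> (\<forall>c v. f' (c *s v) = c * f' v)"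
    by (intro exI[of _ "\<lambda>h. deriv g (f z) * f' h"]) (auto simp: o_def f'(2))
qed

text \<open>The variable \<open>\<xi>\<close> of the single power series that remains after summation over the base exponent.\<close>

definition kernel_variable :: "real \<Rightarrow> 'm::finite \<Rightarrow> complex \<Rightarrow> complex \<Rightarrow> complex ^ (2 + 'm) \<Rightarrow> complex" where
  "kernel_variable \<mu> j l k v = v $ Inr j * cnj k * (1 - v $ Inl 1 * cnj l) powr of_real (- \<mu>)"

definition explicit_kernel :: "real \<Rightarrow> real \<Rightarrow> 'm::finite \<Rightarrow> complex \<Rightarrow> complex \<Rightarrow> complex ^ (2 + 'm) \<Rightarrow> complex" where
  "explicit_kernel C \<mu> j l k v = (1 - v $ Inl 1 * cnj l) powr of_real (- (\<mu> * CARD('m) + 3)) *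
     (of_real (1 / C) * fact CARD('m) * kernel_quadratic \<mu> CARD('m) (kernel_variable \<mu> j l k v)
        / (1 - kernel_variable \<mu> j l k v) ^ (CARD('m) + 3))"

lemma one_minus_mult_cnj:
  assumes "cmod x < 1" "cmod l < 1"
  shows "1 - x * cnj l \<notin> \<real>\<^sub>\<le>\<^sub>0" "1 - x * cnj l \<noteq> 0" "1 - cmod l \<le> cmod (1 - x * cnj l)"
    "(1 - (cmod x)\<^sup>2) * (1 - (cmod l)\<^sup>2) \<le> (cmod (1 - x * cnj l))\<^sup>2"
proof -
  have n: "cmod (x * cnj l) = cmod x * cmod l" by (simp add: norm_mult)
  have xl: "cmod x * cmod l \<le> cmod l" using assms by (intro mult_left_le_one_le) auto
  have "Re (x * cnj l) \<le> cmod (x * cnj l)" by (rule complex_Re_le_cmod)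
  hence "Re (1 - x * cnj l) > 0" using assms xl n by simp
  thus "1 - x * cnj l \<notin> \<real>\<^sub>\<le>\<^sub>0" by (auto simp: complex_nonpos_Reals_iff)
  thus "1 - x * cnj l \<noteq> 0" by auto
  have tri: "1 - cmod x * cmod l \<le> cmod (1 - x * cnj l)"
    using norm_triangle_ineq2[of 1 "x * cnj l"] n by simp
  with xl show "1 - cmod l \<le> cmod (1 - x * cnj l)" by linarith
  have "(1 - (cmod x)\<^sup>2) * (1 - (cmod l)\<^sup>2) = (1 - cmod x * cmod l)\<^sup>2 - (cmod x - cmod l)\<^sup>2"
    by (simp add: power2_eq_square algebra_simps)
  also have "\<dots> \<le> (1 - cmod x * cmod l)\<^sup>2" by simp
  also have "\<dots> \<le> (cmod (1 - x * cnj l))\<^sup>2"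
    using tri xl assms by (intro power_mono) auto
  finally show "(1 - (cmod x)\<^sup>2) * (1 - (cmod l)\<^sup>2) \<le> (cmod (1 - x * cnj l))\<^sup>2" .
qed

text \<open>The bound comes from \<open>(1 - \<bar>x\<bar>\<^sup>2) (1 - \<bar>l\<bar>\<^sup>2) \<le> \<bar>1 - x l'\<bar>\<^sup>2\<close>. It is uniform in \<open>v\<close>, with slack given by the
distance of the fixed point from the boundary; this uniformity makes the kernel bounded and permits
termwise integration.\<close>

lemma kernel_variable_bound:
  fixes j :: "'m::finite"
  assumes \<mu>: "\<mu> > 0" and w: "axis_point j l k \<in> Omega_hat \<mu>"
  obtains q where "0 \<le> q" "q < 1" "\<And>v. v \<in> Omega_hat \<mu> \<Longrightarrow> cmod (kernel_variable \<mu> j l k v) \<le> q"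
proof -
  have l: "cmod l < 1" and k: "(cmod k)\<^sup>2 < (1 - (cmod l)\<^sup>2) powr \<mu>" using w by (auto simp: axis_point_in_Omega_hat)
  define p where "p = (1 - (cmod l)\<^sup>2) powr \<mu>"
  have p: "p > 0" using l by (auto simp: p_def abs_square_eq_1)
  define q where "q = cmod k / sqrt p"
  have q2: "q\<^sup>2 = (cmod k)\<^sup>2 / p" using p by (simp add: q_def power_divide)
  have q0: "q \<ge> 0" using p by (simp add: q_def)
  have "q\<^sup>2 < 1\<^sup>2" unfolding q2 using k p by (simp add: p_def)
  hence q1: "q < 1" using q0 by (simp add: power2_less_imp_less)
  have "cmod (kernel_variable \<mu> j l k v) \<le> q" if v: "v \<in> Omega_hat \<mu>" for v :: "complex ^ (2 + 'm)"
  proof (rule power2_le_imp_le[OF _ q0])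
    let ?x = "v $ Inl 1" and ?y = "v $ Inr j"
    have "axis_point j ?x ?y \<in> Omega_hat \<mu>" by (rule Omega_hat_shrink[OF \<mu> v]) auto
    hence x: "cmod ?x < 1" and y: "(cmod ?y)\<^sup>2 < (1 - (cmod ?x)\<^sup>2) powr \<mu>" by (auto simp: axis_point_in_Omega_hat)
    note om = one_minus_mult_cnj[OF x l]
    let ?z = "cmod (1 - ?x * cnj l)"
    have z: "?z > 0" using om(2) by simp
    have x2: "(cmod ?x)\<^sup>2 \<le> 1" "(cmod l)\<^sup>2 \<le> 1" using x l by (auto simp: power_le_one)
    have "(cmod ?y)\<^sup>2 * p \<le> (1 - (cmod ?x)\<^sup>2) powr \<mu> * (1 - (cmod l)\<^sup>2) powr \<mu>"
      using y p by (simp add: p_def mult_right_mono)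
    also have "\<dots> = ((1 - (cmod ?x)\<^sup>2) * (1 - (cmod l)\<^sup>2)) powr \<mu>"
      using x2 by (simp add: powr_mult)
    also have "\<dots> \<le> (?z\<^sup>2) powr \<mu>"
      using om(4) x2 \<mu> by (intro powr_mono2) auto
    finally have yp: "(cmod ?y)\<^sup>2 * p \<le> (?z\<^sup>2) powr \<mu>" .
    have zz: "(?z powr (- \<mu>))\<^sup>2 = 1 / (?z\<^sup>2) powr \<mu>"
      using z by (simp add: powr_minus power2_eq_square powr_mult field_simps)
    have "(cmod (kernel_variable \<mu> j l k v))\<^sup>2 = (cmod ?y)\<^sup>2 * (cmod k)\<^sup>2 * (?z powr (- \<mu>))\<^sup>2"
      unfolding kernel_variable_def norm_mult cmod_powr_of_real[OF om(2)] by (simp add: power_mult_distrib)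
    also have "\<dots> = ((cmod ?y)\<^sup>2 * p) / (?z\<^sup>2) powr \<mu> * q\<^sup>2"
      unfolding zz q2 using p by (simp add: field_simps)
    also have "\<dots> \<le> 1 * q\<^sup>2"
      using yp z by (intro mult_right_mono) (simp_all add: divide_le_eq_1)
    finally show "(cmod (kernel_variable \<mu> j l k v))\<^sup>2 \<le> q\<^sup>2" by simp
  qed
  with q0 q1 show ?thesis by (rule that)
qed

lemma holomorphic_several_explicit_kernel:
  fixes j :: "'m::finite"
  assumes \<mu>: "\<mu> > 0" and w: "axis_point j l k \<in> Omega_hat \<mu>"
  shows "holomorphic_several (explicit_kernel C \<mu> j l k) (Omega_hat \<mu>)"
proof -
  have l: "cmod l < 1" using w by (auto simp: axis_point_in_Omega_hat)
  obtain q where q: "q < 1" "\<And>v. v \<in> Omega_hat \<mu> \<Longrightarrow> cmod (kernel_variable \<mu> j l k v) \<le> q"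
    by (rule kernel_variable_bound[OF \<mu> w]) blast
  have pw: "holomorphic_several (\<lambda>v. (1 - v $ Inl 1 * cnj l) powr of_real a) (Omega_hat \<mu> :: (complex ^ (2 + 'm)) set)" for a
    by (rule holomorphic_several_compose[OF holomorphic_several_nth, where V = "ball 0 1"])
       (use one_minus_mult_cnj(1)[OF _ l] Omega_hat_component_less_1[OF \<mu>] in \<open>auto intro!: holomorphic_intros\<close>)
  have "holomorphic_several (\<lambda>v. v $ Inr j * cnj k) (Omega_hat \<mu> :: (complex ^ (2 + 'm)) set)"
    by (rule holomorphic_several_compose[OF holomorphic_several_nth, where V = UNIV]) (auto intro!: holomorphic_intros)
  hence kv: "holomorphic_several (kernel_variable \<mu> j l k) (Omega_hat \<mu>)"
    unfolding kernel_variable_def[abs_def] by (rule holomorphic_several_mult[OF _ pw])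
  have "holomorphic_several (\<lambda>v. (\<lambda>x. of_real (1 / C) * fact CARD('m) * kernel_quadratic \<mu> CARD('m) x / (1 - x) ^ (CARD('m) + 3)) (kernel_variable \<mu> j l k v)) (Omega_hat \<mu>)"
  proof (rule holomorphic_several_compose[OF kv, where V = "ball 0 1"])
    show "(\<lambda>x. of_real (1 / C) * fact CARD('m) * kernel_quadratic \<mu> CARD('m) x / (1 - x) ^ (CARD('m) + 3)) holomorphic_on ball 0 1"
      unfolding kernel_quadratic_def by (intro holomorphic_intros) auto
    show "kernel_variable \<mu> j l k v \<in> ball 0 1" if "v \<in> Omega_hat \<mu>" for v
      using q(2)[OF that] q(1) by simp
  qed simp
  thus ?thesis
    unfolding explicit_kernel_def[abs_def] by (intro holomorphic_several_mult[OF pw])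
qed

text \<open>The base exponent has already been summed in each term; this is the form in which the kernel is
integrated.\<close>

lemma explicit_kernel_sums:
  fixes j :: "'m::finite"
  assumes \<mu>: "\<mu> > 0" and w: "axis_point j l k \<in> Omega_hat \<mu>" and v: "v \<in> Omega_hat \<mu>"
  shows "(\<lambda>b. of_real (1 / C) * (of_real (kernel_coeff \<mu> CARD('m) b) * cnj k ^ b) *
      (v $ Inr j ^ b * (1 - v $ Inl 1 * cnj l) powr of_real (- (\<mu> * (b + CARD('m)) + 3)))) sums explicit_kernel C \<mu> j l k v"
proof -
  have l: "cmod l < 1" using w by (auto simp: axis_point_in_Omega_hat)
  obtain q where q: "q < 1" "\<And>v. v \<in> Omega_hat \<mu> \<Longrightarrow> cmod (kernel_variable \<mu> j l k v) \<le> q"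
    by (rule kernel_variable_bound[OF \<mu> w]) blast
  let ?\<xi> = "kernel_variable \<mu> j l k v" and ?z = "1 - v $ Inl 1 * cnj l"
  have z0: "?z \<noteq> 0" by (rule one_minus_mult_cnj(2)[OF Omega_hat_component_less_1[OF \<mu> v] l])
  have s: "(\<lambda>b. ?z powr of_real (- (\<mu> * CARD('m) + 3)) * of_real (1 / C) * (of_real (kernel_coeff \<mu> CARD('m) b) * ?\<xi> ^ b))
     sums (?z powr of_real (- (\<mu> * CARD('m) + 3)) * of_real (1 / C) * (fact CARD('m) * kernel_quadratic \<mu> CARD('m) ?\<xi> / (1 - ?\<xi>) ^ (CARD('m) + 3)))"
    using q(2)[OF v] q(1) by (intro sums_mult kernel_coeff_sums) simp
  have e: "?z powr of_real (- (\<mu> * CARD('m) + 3)) * of_real (1 / C) * (of_real (kernel_coeff \<mu> CARD('m) b) * ?\<xi> ^ b)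
     = of_real (1 / C) * (of_real (kernel_coeff \<mu> CARD('m) b) * cnj k ^ b) *
      (v $ Inr j ^ b * ?z powr of_real (- (\<mu> * (b + CARD('m)) + 3)))" for b
  proof -
    have "?z powr of_real (- (\<mu> * (b + CARD('m)) + 3)) = ?z powr (of_real (- (\<mu> * CARD('m) + 3)) + of_nat b * of_real (- \<mu>))"
      by (simp add: algebra_simps)
    also have "\<dots> = ?z powr of_real (- (\<mu> * CARD('m) + 3)) * (?z powr of_real (- \<mu>)) ^ b"
      using z0 by (simp only: powr_add) (simp add: powr_def exp_of_nat_mult[symmetric] mult_ac)
    finally show ?thesis by (simp add: kernel_variable_def power_mult_distrib mult_ac)
  qed
  have t: "?z powr of_real (- (\<mu> * CARD('m) + 3)) * of_real (1 / C) * (fact CARD('m) * kernel_quadratic \<mu> CARD('m) ?\<xi> / (1 - ?\<xi>) ^ (CARD('m) + 3))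
      = explicit_kernel C \<mu> j l k v"
    by (simp only: explicit_kernel_def mult.assoc times_divide_eq_right)
  show ?thesis using s unfolding e t .
qed

lemma explicit_kernel_term_bound:
  fixes j :: "'m::finite"
  assumes \<mu>: "\<mu> > 0" and w: "axis_point j l k \<in> Omega_hat \<mu>" and v: "v \<in> Omega_hat \<mu>" and C: "C > 0"
    and q: "cmod (kernel_variable \<mu> j l k v) \<le> q"
  shows "cmod (of_real (1 / C) * (of_real (kernel_coeff \<mu> CARD('m) b) * cnj k ^ b) *
      (v $ Inr j ^ b * (1 - v $ Inl 1 * cnj l) powr of_real (- (\<mu> * (b + CARD('m)) + 3))))
    \<le> 1 / C * (1 - cmod l) powr (- (\<mu> * CARD('m) + 3)) * (kernel_coeff \<mu> CARD('m) b * q ^ b)"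
proof -
  have l: "cmod l < 1" using w by (auto simp: axis_point_in_Omega_hat)
  let ?z = "cmod (1 - v $ Inl 1 * cnj l)"
  note om = one_minus_mult_cnj[OF Omega_hat_component_less_1[OF \<mu> v, of "Inl 1"] l]
  have z: "?z > 0" using om(2) by simp
  have kv: "cmod (kernel_variable \<mu> j l k v) = cmod (v $ Inr j) * cmod k * ?z powr (- \<mu>)"
    unfolding kernel_variable_def norm_mult cmod_powr_of_real[OF om(2)] by simp
  have "?z powr (- (\<mu> * (b + CARD('m)) + 3)) = ?z powr (- (\<mu> * CARD('m) + 3) + real b * (- \<mu>))"
    by (simp add: algebra_simps)
  also have "\<dots> = ?z powr (- (\<mu> * CARD('m) + 3)) * (?z powr (- \<mu>)) ^ b"
    unfolding powr_add using z by (simp add: powr_powr mult.commute flip: powr_realpow)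
  finally have e: "?z powr (- (\<mu> * (b + CARD('m)) + 3)) = \<dots>" .
  have "cmod (of_real (1 / C) * (of_real (kernel_coeff \<mu> CARD('m) b) * cnj k ^ b) *
      (v $ Inr j ^ b * (1 - v $ Inl 1 * cnj l) powr of_real (- (\<mu> * (b + CARD('m)) + 3))))
    = 1 / C * ?z powr (- (\<mu> * CARD('m) + 3)) * (kernel_coeff \<mu> CARD('m) b * cmod (kernel_variable \<mu> j l k v) ^ b)"
    unfolding norm_mult cmod_powr_of_real[OF om(2)] e kv
    using C kernel_coeff_nonneg[OF \<mu>, of "CARD('m)" b] by (simp add: norm_power norm_divide power_mult_distrib)
  also have "\<dots> \<le> 1 / C * (1 - cmod l) powr (- (\<mu> * CARD('m) + 3)) * (kernel_coeff \<mu> CARD('m) b * q ^ b)"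
  proof -
    have "0 \<le> \<mu> * real CARD('m)" using \<mu> by simp
    hence n0: "- (\<mu> * real CARD('m)) \<le> 3" by linarith
    show ?thesis
      using n0 C l om(3) q kernel_coeff_nonneg[OF \<mu>, of "CARD('m)" b] \<mu>
      by (intro mult_mono power_mono powr_mono2') auto
  qed
  finally show ?thesis .
qed

lemma explicit_kernel_in_bergman_space:
  fixes j :: "'m::finite"
  assumes \<mu>: "\<mu> > 0" and w: "axis_point j l k \<in> Omega_hat \<mu>" and C: "C > 0"
  shows "explicit_kernel C \<mu> j l k \<in> bergman_space (Omega_hat \<mu>)"
proof -
  let ?D = "Omega_hat \<mu> :: (complex ^ (2 + 'm)) set"
  let ?K = "explicit_kernel C \<mu> j l k"
  obtain q where q: "0 \<le> q" "q < 1" "\<And>v. v \<in> ?D \<Longrightarrow> cmod (kernel_variable \<mu> j l k v) \<le> q"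
    by (rule kernel_variable_bound[OF \<mu> w]) blast
  define B where "B b = 1 / C * (1 - cmod l) powr (- (\<mu> * CARD('m) + 3)) * (kernel_coeff \<mu> CARD('m) b * q ^ b)" for b
  have B: "summable B" unfolding B_def using q by (intro summable_mult kernel_coeff_summable) auto
  have KB: "cmod (?K v) \<le> suminf B" if v: "v \<in> ?D" for v
  proof -
    note s = explicit_kernel_sums[OF \<mu> w v, of C]
    show ?thesis
      unfolding sums_unique[OF s] B_def
      by (intro norm_suminf_le explicit_kernel_term_bound[OF \<mu> w v C q(3)[OF v]] B[unfolded B_def])
  qed
  note hol = holomorphic_several_explicit_kernel[OF \<mu> w, of C]
  have [measurable]: "?D \<in> sets borel" by (rule borel_open, rule open_Omega_hat)
  have cont: "continuous_on ?D (\<lambda>v. (cmod (?K v))\<^sup>2)"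
    by (intro continuous_intros holomorphic_several_imp_continuous_on hol)
  have "set_integrable lborel ?D (\<lambda>_. (suminf B)\<^sup>2)"
    using emeasure_bounded_finite[OF bounded_Omega_hat[OF \<mu>, where 'm = 'm]] by (simp add: set_integrable_def)
  hence "set_integrable lborel ?D (\<lambda>v. (cmod (?K v))\<^sup>2)"
  proof (rule set_integrable_bound)
    show "set_borel_measurable lborel ?D (\<lambda>v. (cmod (?K v))\<^sup>2)"
      unfolding set_borel_measurable_def
      using borel_measurable_continuous_on_indicator[OF _ cont] by simp
    show "AE v in lborel. v \<in> ?D \<longrightarrow> norm ((cmod (?K v))\<^sup>2) \<le> norm ((suminf B)\<^sup>2)"
      using KB by (auto intro!: power_mono)
  qed
  with hol show ?thesis by (simp add: bergman_space_def)
qed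

text \<open>Integrating the series term by term against \<open>f\<close>, first over \<open>b\<close> and for each \<open>b\<close> over \<open>a\<close>, the squared
norms of the monomials cancel against the coefficients of the kernel and the Taylor series of \<open>f\<close> at
the axis point is left. The constant \<open>C\<close> is that of the moments.\<close>

lemma explicit_kernel_reproduces:
  fixes j :: "'m::finite"
  assumes \<mu>: "\<mu> > 0"
  obtains C where "C > 0"
    "\<And>l k. axis_point j l k \<in> Omega_hat \<mu> \<Longrightarrow> reproduces_at (Omega_hat \<mu>) (axis_point j l k) (explicit_kernel C \<mu> j l k)"
proof -
  let ?D = "Omega_hat \<mu> :: (complex ^ (2 + 'm)) set"
  let ?m = "CARD('m)"
  have [measurable]: "?D \<in> sets borel" by (rule borel_open, rule open_Omega_hat)
  define M where "M a b = fact a * Gamma (\<mu> * (b + ?m) + 1) / Gamma (\<mu> * (b + ?m) + a + 3) * (fact b / fact (b + ?m))" for a b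
  obtain C where C: "C > 0" "\<And>a b. (\<integral>\<^sup>+v. ennreal (cmod (v $ Inl 1) ^ (2 * a) * cmod (v $ Inr j) ^ (2 * b)) * indicator ?D v
        \<partial>lborel) = ennreal (C * M a b)"
    unfolding M_def by (rule Omega_hat_moment[OF \<mu>, of j]) blast
  have s_pos: "\<mu> * (b + ?m) > 0" for b using \<mu> by (simp add: add_nonneg_pos)
  have M0: "M a b \<ge> 0" for a b
    using s_pos[of b] by (auto simp: M_def intro!: mult_nonneg_nonneg divide_nonneg_nonneg Gamma_real_nonneg)
  have mom: "(LINT v:?D|lborel. (v $ Inl 1 ^ a * v $ Inr j ^ b) * cnj (v $ Inl 1 ^ a * v $ Inr j ^ b)) = of_real (C * M a b)" for a b
  proof -
    let ?h = "\<lambda>v :: complex ^ (2 + 'm). indicator ?D v * (cmod (v $ Inl 1) ^ (2 * a) * cmod (v $ Inr j) ^ (2 * b))"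
    have "indicator ?D v *\<^sub>R ((v $ Inl 1 ^ a * v $ Inr j ^ b) * cnj (v $ Inl 1 ^ a * v $ Inr j ^ b)) = of_real (?h v)" for v
      by (simp only: complex_norm_square[symmetric])
         (simp add: scaleR_conv_of_real norm_mult norm_power power_mult_distrib flip: power_mult, simp add: mult.commute)
    hence "(LINT v:?D|lborel. (v $ Inl 1 ^ a * v $ Inr j ^ b) * cnj (v $ Inl 1 ^ a * v $ Inr j ^ b)) = (\<integral>v. of_real (?h v) \<partial>lborel)"
      unfolding set_lebesgue_integral_def by (rule Bochner_Integration.integral_cong[OF refl])
    also have "\<dots> = of_real (\<integral>v. ?h v \<partial>lborel)" by (rule integral_complex_of_real)
    also have "(\<integral>v. ?h v \<partial>lborel) = enn2real (\<integral>\<^sup>+v. ennreal (?h v) \<partial>lborel)"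
      by (rule integral_eq_nn_integral) auto
    also have "(\<integral>\<^sup>+v. ennreal (?h v) \<partial>lborel) = ennreal (C * M a b)"
      unfolding C(2)[symmetric] by (intro nn_integral_cong) (auto simp: indicator_def)
    finally show ?thesis using C(1) M0[of a b] by simp
  qed
  have pull: "(LINT v:?D|lborel. a * h v) = a * (LINT v:?D|lborel. h v)" for a :: complex and h
    unfolding set_lebesgue_integral_def mult_scaleR_right[symmetric] by (rule integral_mult_right_zero)
  \<comment> \<open>the coefficient of a monomial in the kernel is the reciprocal of its squared norm\<close>
  have norm1: "kernel_coeff \<mu> ?m b / C * (pochhammer (\<mu> * (b + ?m) + 3) a / fact a * (C * M a b)) = 1" for a b
  proof -
    let ?\<sigma> = "\<mu> * (b + ?m)"
    have nn: "?\<sigma> + 3 \<notin> \<int>\<^sub>\<le>\<^sub>0" "?\<sigma> + 1 \<notin> \<int>\<^sub>\<le>\<^sub>0" "?\<sigma> + 2 \<notin> \<int>\<^sub>\<le>\<^sub>0" using s_pos[of b] by (auto dest: nonpos_Ints_nonpos)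
    have G3: "Gamma (?\<sigma> + 3) = (?\<sigma> + 2) * ((?\<sigma> + 1) * Gamma (?\<sigma> + 1))"
      using Gamma_plus1[OF nn(2)] Gamma_plus1[OF nn(3)] by (simp add: add.assoc)
    have pos: "Gamma (?\<sigma> + 1) > 0" "Gamma (?\<sigma> + 3 + a) > 0" using s_pos[of b] by (auto intro!: Gamma_real_pos)
    have cm: "?\<sigma> + a + 3 = ?\<sigma> + 3 + a" by simp
    have alg: "F / D * (u * w) / C * (GA / (w * (u * G1)) / fa * (C * (fa * G1 / GA * (D / F)))) = 1"
      if "F \<noteq> 0" "D \<noteq> 0" "GA \<noteq> 0" "G1 \<noteq> 0" "fa \<noteq> 0" "u \<noteq> 0" "w \<noteq> 0" for F D GA G1 fa u w :: real
      using that C(1) by (simp add: divide_simps)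
    show ?thesis
      unfolding pochhammer_Gamma[OF nn(1)] M_def kernel_coeff_def cm G3
      by (rule alg) (use pos[THEN less_imp_neq, THEN not_sym] s_pos[of b] in simp_all)
  qed
  have "reproduces_at ?D (axis_point j l k) (explicit_kernel C \<mu> j l k)" if w: "axis_point j l k \<in> ?D" for l k
    unfolding reproduces_at_def
  proof (intro conjI ballI)
    show "explicit_kernel C \<mu> j l k \<in> bergman_space ?D"
      by (rule explicit_kernel_in_bergman_space[OF \<mu> w C(1)])
    fix f assume f: "f \<in> bergman_space ?D"
    have l: "cmod l < 1" using w by (auto simp: axis_point_in_Omega_hat)
    have fi: "set_integrable lborel ?D f" by (rule bergman_space_imp_integrable[OF f open_Omega_hat bounded_Omega_hat[OF \<mu>]])
    obtain c where c: "\<And>a b. (LINT v:?D|lborel. f v * cnj (v $ Inl 1 ^ a * v $ Inr j ^ b)) = c a b * of_real (C * M a b)"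
      "\<And>x y. axis_point j x y \<in> ?D \<Longrightarrow> \<exists>g. (\<forall>b. (\<lambda>a. c a b * x ^ a) sums g b) \<and> (\<lambda>b. g b * y ^ b) sums f (axis_point j x y)"
      using monomial_coefficients[OF \<mu> f, of j] unfolding mom by blast
    obtain g where g: "\<And>b. (\<lambda>a. c a b * l ^ a) sums g b" "(\<lambda>b. g b * k ^ b) sums f (axis_point j l k)"
      using c(2)[OF w] by blast
    let ?z = "\<lambda>v :: complex ^ (2 + 'm). 1 - v $ Inl 1 * cnj l"
    define t where "t b v = v $ Inr j ^ b * ?z v powr of_real (- (\<mu> * (b + ?m) + 3))" for b and v :: "complex ^ (2 + 'm)"
    have zc: "continuous_on ?D (\<lambda>v. ?z v powr of_real a)" for a
    proof (rule continuous_on_compose2[where f = "\<lambda>v. v $ Inl 1" and g = "\<lambda>x. (1 - x * cnj l) powr of_real a" and t = "ball 0 1"])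
      have "(\<lambda>x. (1 - x * cnj l) powr of_real a) holomorphic_on ball 0 1"
        using one_minus_mult_cnj(1)[OF _ l] by (auto intro!: holomorphic_intros)
      thus "continuous_on (ball 0 1) (\<lambda>x. (1 - x * cnj l) powr of_real a)"
        by (rule holomorphic_on_imp_continuous_on)
    qed (use Omega_hat_component_less_1[OF \<mu>] in \<open>auto intro!: continuous_intros\<close>)
    have inner: "of_real (kernel_coeff \<mu> ?m b / C) * (LINT v:?D|lborel. f v * cnj (t b v)) = g b" for b
    proof -
      let ?\<sigma> = "\<mu> * (b + ?m) + 3"
      have s0: "?\<sigma> > 0" using s_pos[of b] by simp
      define r where "r a = pochhammer ?\<sigma> a / fact a" for a
      have r0: "r a \<ge> 0" for a using s0 by (simp add: r_def pochhammer_nonneg)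
      have rs: "(\<lambda>a. of_real (r a) * x ^ a) sums (1 - x) powr of_real (- ?\<sigma>)" if "cmod x < 1" for x
        using sums_one_minus_powr[OF that, of "of_real ?\<sigma>"] by (simp add: r_def flip: pochhammer_of_real)
      have rl: "summable (\<lambda>a. r a * cmod l ^ a)"
      proof -
        have "summable (\<lambda>a. complex_of_real (r a * cmod l ^ a))"
          using rs[of "of_real (cmod l)"] l by (simp add: sums_iff)
        thus ?thesis by (simp only: summable_of_real_iff)
      qed
      have "(\<lambda>a. LINT v:?D|lborel. f v * cnj (of_real (r a) * cnj l ^ a * (v $ Inl 1 ^ a * v $ Inr j ^ b))) sums (LINT v:?D|lborel. f v * cnj (t b v))"
      proof (rule set_integral_mult_cnj_sums[OF open_Omega_hat fi _ _ rl])
        fix v a assume v: "v \<in> ?D"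
        have "cmod (v $ Inl 1 ^ a * v $ Inr j ^ b) \<le> 1"
          using Omega_hat_component_less_1[OF \<mu> v] by (simp add: norm_mult norm_power mult_le_one power_le_one less_imp_le)
        thus "cmod (of_real (r a) * cnj l ^ a * (v $ Inl 1 ^ a * v $ Inr j ^ b)) \<le> r a * cmod l ^ a"
          using r0[of a] by (subst norm_mult) (auto simp: norm_mult norm_power intro!: mult_left_le)
      next
        fix v assume v: "v \<in> ?D"
        have "cmod (v $ Inl 1 * cnj l) < 1 * 1"
          unfolding norm_mult using l Omega_hat_component_less_1[OF \<mu> v] by (intro mult_strict_mono') auto
        hence "(\<lambda>a. v $ Inr j ^ b * (of_real (r a) * (v $ Inl 1 * cnj l) ^ a)) sums t b v"
          unfolding t_def by (intro sums_mult rs) simp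
        thus "(\<lambda>a. of_real (r a) * cnj l ^ a * (v $ Inl 1 ^ a * v $ Inr j ^ b)) sums t b v"
          by (simp add: power_mult_distrib mult_ac)
      qed (intro continuous_intros)
      hence "(\<lambda>a. of_real (kernel_coeff \<mu> ?m b / C) * (LINT v:?D|lborel. f v * cnj (of_real (r a) * cnj l ^ a * (v $ Inl 1 ^ a * v $ Inr j ^ b))))
          sums (of_real (kernel_coeff \<mu> ?m b / C) * (LINT v:?D|lborel. f v * cnj (t b v)))"
        by (rule sums_mult)
      moreover have "of_real (kernel_coeff \<mu> ?m b / C) * (LINT v:?D|lborel. f v * cnj (of_real (r a) * cnj l ^ a * (v $ Inl 1 ^ a * v $ Inr j ^ b)))
          = c a b * l ^ a" for a
      proof -
        have "(LINT v:?D|lborel. f v * cnj (of_real (r a) * cnj l ^ a * (v $ Inl 1 ^ a * v $ Inr j ^ b)))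
          = (LINT v:?D|lborel. (of_real (r a) * l ^ a) * (f v * cnj (v $ Inl 1 ^ a * v $ Inr j ^ b)))"
          by (simp add: mult_ac)
        also have "\<dots> = (of_real (r a) * l ^ a) * (c a b * of_real (C * M a b))"
          by (simp only: pull c(1))
        finally have "of_real (kernel_coeff \<mu> ?m b / C) * (LINT v:?D|lborel. f v * cnj (of_real (r a) * cnj l ^ a * (v $ Inl 1 ^ a * v $ Inr j ^ b)))
          = of_real (kernel_coeff \<mu> ?m b / C * (r a * (C * M a b))) * (c a b * l ^ a)"
          by (simp only: of_real_mult mult_ac)
        thus ?thesis by (simp only: r_def norm1 of_real_1 mult_1_left)
      qed
      ultimately show ?thesis using g(1)[of b] by (simp add: sums_unique2)
    qed
    obtain q where q: "0 \<le> q" "q < 1" "\<And>v. v \<in> ?D \<Longrightarrow> cmod (kernel_variable \<mu> j l k v) \<le> q"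
      by (rule kernel_variable_bound[OF \<mu> w]) blast
    define B where "B b = 1 / C * (1 - cmod l) powr (- (\<mu> * ?m + 3)) * (kernel_coeff \<mu> ?m b * q ^ b)" for b
    have B: "summable B" unfolding B_def using q by (intro summable_mult kernel_coeff_summable) auto
    have "(\<lambda>b. LINT v:?D|lborel. f v * cnj (of_real (1 / C) * (of_real (kernel_coeff \<mu> ?m b) * cnj k ^ b) * t b v))
       sums (LINT v:?D|lborel. f v * cnj (explicit_kernel C \<mu> j l k v))"
    proof (rule set_integral_mult_cnj_sums[OF open_Omega_hat fi _ _ B])
      show "continuous_on ?D (\<lambda>v. of_real (1 / C) * (of_real (kernel_coeff \<mu> ?m b) * cnj k ^ b) * t b v)" for b
        unfolding t_def by (intro continuous_intros zc)
    next
      fix v b assume "v \<in> ?D"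
      thus "cmod (of_real (1 / C) * (of_real (kernel_coeff \<mu> ?m b) * cnj k ^ b) * t b v) \<le> B b"
        unfolding t_def B_def by (intro explicit_kernel_term_bound[OF \<mu> w _ C(1)] q)
    next
      fix v assume "v \<in> ?D"
      thus "(\<lambda>b. of_real (1 / C) * (of_real (kernel_coeff \<mu> ?m b) * cnj k ^ b) * t b v) sums explicit_kernel C \<mu> j l k v"
        unfolding t_def by (rule explicit_kernel_sums[OF \<mu> w])
    qed
    moreover have "(LINT v:?D|lborel. f v * cnj (of_real (1 / C) * (of_real (kernel_coeff \<mu> ?m b) * cnj k ^ b) * t b v)) = g b * k ^ b" for b
    proof -
      have "(LINT v:?D|lborel. f v * cnj (of_real (1 / C) * (of_real (kernel_coeff \<mu> ?m b) * cnj k ^ b) * t b v))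
        = (LINT v:?D|lborel. (k ^ b * of_real (kernel_coeff \<mu> ?m b / C)) * (f v * cnj (t b v)))"
        by (simp add: mult_ac)
      also have "\<dots> = g b * k ^ b"
        by (simp only: pull mult.assoc inner) (rule mult.commute)
      finally show ?thesis .
    qed
    ultimately show "f (axis_point j l k) = (LINT v:?D|lborel. f v * cnj (explicit_kernel C \<mu> j l k v))"
      using g(2) by (simp add: sums_unique2)
  qed
  with C(1) show ?thesis by (rule that)
qed

section \<open>Reduction of the second point to two coordinates\<close>

definition hermitian :: "complex ^ 'n::finite \<Rightarrow> complex ^ 'n \<Rightarrow> complex" where
  "hermitian v w = (\<Sum>i\<in>UNIV. v $ i * cnj (w $ i))"

lemma hermitian_self: "hermitian v v = of_real ((norm v)\<^sup>2)"
  by (simp add: hermitian_def norm_vec_def L2_set_def sum_nonneg complex_norm_square del: of_real_power)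

lemma hermitian_cnj: "cnj (hermitian v w) = hermitian w v"
  by (simp add: hermitian_def mult.commute)

lemma hermitian_diff_left: "hermitian (a - b) w = hermitian a w - hermitian b w"
  by (simp add: hermitian_def algebra_simps sum_subtractf)

lemma hermitian_scale_left: "hermitian (c *s a) w = c * hermitian a w"
  by (simp add: hermitian_def sum_distrib_left mult.assoc)

lemma hermitian_diff_right: "hermitian w (a - b) = hermitian w a - hermitian w b"
  by (simp add: hermitian_def algebra_simps sum_subtractf)

lemma hermitian_scale_right: "hermitian w (c *s a) = cnj c * hermitian w a"
  by (simp add: hermitian_def sum_distrib_left mult_ac)

lemmas hermitian_simps = hermitian_diff_left hermitian_diff_right hermitian_scale_left hermitian_scale_right

lemma hermitian_axis_right: "hermitian w (axis j c) = w $ j * cnj c"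
proof -
  have "hermitian w (axis j c) = (\<Sum>i\<in>UNIV. if i = j then w $ j * cnj c else 0)"
    unfolding hermitian_def axis_def by (intro sum.cong) auto
  thus ?thesis by simp
qed

lemma linear_if_complex_linear:
  fixes T :: "complex ^ 'n \<Rightarrow> complex ^ 'k"
  assumes "\<And>a b. T (a + b) = T a + T b" "\<And>c a. T (c *s a) = c *s T a"
  shows "linear T"
proof (rule linearI)
  show "T (r *\<^sub>R a) = r *\<^sub>R T a" for r a
  proof -
    have sc: "s *\<^sub>R x = of_real s *s x" for s and x :: "complex ^ 'l"
      by (simp add: vec_eq_iff) (simp add: scaleR_conv_of_real)
    show ?thesis unfolding sc by (rule assms)
  qed
qed (rule assms)

text \<open>Householder reflections suffice below, so only unitary maps that are their own inverses are
considered; this spares a separate treatment of the inverse.\<close>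

definition unitary_involution :: "(complex ^ 'n \<Rightarrow> complex ^ 'n) \<Rightarrow> bool" where
  "unitary_involution T \<longleftrightarrow> (\<forall>a b. T (a + b) = T a + T b) \<and> (\<forall>c a. T (c *s a) = c *s T a)
     \<and> (\<forall>v. norm (T v) = norm v) \<and> (\<forall>v. T (T v) = v)"

text \<open>The reflection that exchanges \<open>w\<close> with \<open>axis j c\<close>, where \<open>c\<close> has modulus \<open>norm w\<close>. In the complex
setting this requires the inner product of \<open>w\<close> and \<open>axis j c\<close> to be real, which fixes the phase of \<open>c\<close>.\<close>

lemma householder_to_axis:
  fixes w :: "complex ^ 'n::finite" and j :: 'n
  obtains T c where "unitary_involution T" "T w = axis j c"
proof -
  \<comment> \<open>the phase of \<open>w $ j\<close> makes the inner product real; if \<open>w $ j = 0\<close>, any phase does\<close>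
  define c where "c = (if w $ j = 0 then of_real (norm w) else of_real (norm w) * sgn (w $ j))"
  have nc: "cmod c = norm w" by (simp add: c_def norm_mult norm_sgn)
  have "w $ j * cnj (sgn (w $ j)) = of_real (cmod (w $ j))"
    using complex_norm_square[of "w $ j"] by (cases "w $ j = 0") (simp_all add: sgn_eq power2_eq_square field_simps)
  hence "w $ j * cnj c = of_real (norm w * cmod (w $ j))"
    by (simp add: c_def mult.left_commute)
  hence wc: "Im (w $ j * cnj c) = 0" by simp
  define u where "u = w - axis j c"
  define k where "k v = 2 * hermitian v u / of_real ((norm u)\<^sup>2)" for v
  define T where "T v = v - k v *s u" for v
  have kadd: "k (a + b) = k a + k b" for a b
    by (simp add: k_def hermitian_def algebra_simps sum.distrib add_divide_distrib)
  have kscale: "k (r *s a) = r * k a" for r a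
    by (simp add: k_def hermitian_scale_left)
  have Tadd: "T (a + b) = T a + T b" for a b by (simp add: T_def kadd vec_eq_iff algebra_simps)
  have Tscale: "T (r *s a) = r *s T a" for r a by (simp add: T_def kscale vec_eq_iff algebra_simps)
  have ku: "u \<noteq> 0 \<Longrightarrow> k u = 2" by (simp add: k_def hermitian_self)
  have TT: "T (T v) = v" for v
  proof (cases "u = 0")
    case False
    have "k (T v) = k v - k v * k u"
      using kadd[of v "(- k v) *s u"] kscale[of "- k v" u] by (simp add: T_def vector_smult_lneg)
    hence "k (T v) = - k v" using ku[OF False] by simp
    hence "T (T v) = T v + k v *s u" by (simp add: T_def[of "T v"] vector_smult_lneg)
    thus ?thesis by (simp add: T_def)
  qed (simp add: T_def)
  have nT: "norm (T v) = norm v" for v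
  proof (cases "u = 0")
    case False
    let ?n = "of_real ((norm u)\<^sup>2) :: complex"
    have n0: "?n \<noteq> 0" using False by simp
    have hk: "hermitian v u = k v * ?n / 2" using n0 by (simp add: k_def)
    have hk': "hermitian u v = cnj (k v) * ?n / 2"
      using hermitian_cnj[of v u] by (simp add: hk)
    have "hermitian (T v) (T v) = hermitian v v - cnj (k v) * hermitian v u - k v * hermitian u v + k v * cnj (k v) * hermitian u u"
      by (simp add: T_def hermitian_simps algebra_simps)
    also have "\<dots> = hermitian v v" unfolding hk hk' hermitian_self[of u] by (simp add: algebra_simps)
    finally have "(norm (T v))\<^sup>2 = (norm v)\<^sup>2" unfolding hermitian_self of_real_eq_iff .
    thus ?thesis by simp
  qed (simp add: T_def)
  have Tw: "T w = axis j c"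
  proof (cases "u = 0")
    case False
    let ?h = "w $ j * cnj c"
    have "cnj ?h = ?h" using wc by (simp add: complex_eq_iff)
    hence ch: "c * cnj (w $ j) = ?h" by (simp add: mult.commute)
    have axw: "hermitian (axis j c) w = ?h"
      using hermitian_cnj[of w "axis j c"] ch by (simp add: hermitian_axis_right mult.commute)
    have wax: "hermitian w (axis j c) = ?h" by (rule hermitian_axis_right)
    have cc: "hermitian (axis j c) (axis j c) = of_real ((norm w)\<^sup>2)"
      by (simp add: hermitian_self norm_axis_complex nc)
    have "of_real ((norm u)\<^sup>2) = hermitian u u" by (simp add: hermitian_self)
    also have "\<dots> = 2 * (of_real ((norm w)\<^sup>2) - ?h)"
      unfolding u_def hermitian_diff_left hermitian_diff_right axw cc wax hermitian_self[of w] by simp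
    also have "of_real ((norm w)\<^sup>2) - ?h = hermitian w u"
      unfolding u_def hermitian_diff_right hermitian_axis_right hermitian_self ..
    finally have e: "of_real ((norm u)\<^sup>2) = 2 * hermitian w u" .
    have "k w = 1" unfolding k_def e[symmetric] using False by simp
    thus ?thesis by (simp add: T_def u_def)
  qed (simp add: T_def u_def)
  show ?thesis
  proof (rule that[of T c])
    show "unitary_involution T" using Tadd Tscale nT TT by (simp add: unitary_involution_def)
  qed fact
qed

lemma norm_join_parts: "(norm (join_parts p))\<^sup>2 = (norm (fst p))\<^sup>2 + (norm (snd p))\<^sup>2"
proof -
  have "(norm (join_parts p))\<^sup>2 = (\<Sum>i\<in>UNIV <+> UNIV. (cmod (join_parts p $ i))\<^sup>2)"
    by (simp add: norm_vec_def L2_set_def sum_nonneg)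
  also have "\<dots> = (norm (fst p))\<^sup>2 + (norm (snd p))\<^sup>2"
    by (subst sum.Plus) (simp_all add: norm_vec_def L2_set_def sum_nonneg)
  finally show ?thesis .
qed

lemma unitary_to_axis_point:
  fixes w :: "complex ^ (2 + 'm::finite)" and j :: 'm
  obtains T l k where "unitary_involution T" "T w = axis_point j l k"
    "\<And>v. T v \<in> Omega_hat \<mu> \<longleftrightarrow> v \<in> Omega_hat \<mu>"
proof -
  obtain A l where A: "unitary_involution A" "A (base_part w) = axis 1 l" by (rule householder_to_axis)
  obtain B k where B: "unitary_involution B" "B (fibre_part w) = axis j k" by (rule householder_to_axis)
  define T where "T v = join_parts (A (base_part v), B (fibre_part v))" for v
  have bp: "base_part (a + b) = base_part a + base_part b" "fibre_part (a + b) = fibre_part a + fibre_part b"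
    "base_part (c *s a) = c *s base_part a" "fibre_part (c *s a) = c *s fibre_part a"
    for a b :: "complex ^ (2 + 'm)" and c by (simp_all add: vec_eq_iff)
  have jp: "join_parts (x, y) + join_parts (x', y') = (join_parts (x + x', y + y') :: complex ^ (2 + 'm))"
    "c *s join_parts (x, y) = (join_parts (c *s x, c *s y) :: complex ^ (2 + 'm))" for x y x' y' c
    by (simp_all add: vec_eq_iff join_parts_def split: sum.splits)
  show ?thesis
  proof (rule that[of T l k])
    have "(norm (T v))\<^sup>2 = (norm v)\<^sup>2" for v
      using norm_join_parts[of "(base_part v, fibre_part v)"] A B
      by (simp add: T_def norm_join_parts unitary_involution_def)
    thus "unitary_involution T"
      using A B unfolding unitary_involution_def by (auto simp: T_def bp jp)
    show "T w = axis_point j l k"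
      unfolding vec_eq_iff T_def A(2) B(2) by (auto simp: join_parts_def axis_def split: sum.splits)
    show "T v \<in> Omega_hat \<mu> \<longleftrightarrow> v \<in> Omega_hat \<mu>" for v
      using A B by (simp add: T_def Omega_hat_iff unitary_involution_def)
  qed
qed

lemma reproduces_at_unitary:
  fixes D :: "(complex ^ 'n::finite) set"
  assumes T: "unitary_involution T" and D: "open D" and TD: "\<And>v. T v \<in> D \<longleftrightarrow> v \<in> D"
    and k: "reproduces_at D (T w) k"
  shows "reproduces_at D w (\<lambda>v. k (T v))"
proof -
  have Tadd: "T (a + b) = T a + T b" and Tscale: "T (c *s a) = c *s T a" and nT: "norm (T v) = norm v" and TT: "T (T v) = v"
    for a b c v using T by (auto simp: unitary_involution_def)
  have lin: "linear T" using Tadd Tscale by (rule linear_if_complex_linear)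
  hence blin: "bounded_linear T" by (simp add: linear_conv_bounded_linear)
  have Tm[measurable]: "T \<in> borel_measurable borel"
    by (intro borel_measurable_continuous_onI linear_continuous_on blin)
  have [measurable]: "D \<in> sets borel" using D by simp
  note dT = distr_lborel_isometry[OF lin nT]
  have inv: "set_integrable lborel D (\<lambda>v. h (T v)) \<longleftrightarrow> set_integrable lborel D h"
    "(LINT v:D|lborel. h (T v)) = (LINT v:D|lborel. h v)"
    if "continuous_on D h" for h :: "complex ^ 'n \<Rightarrow> 'z::{banach, second_countable_topology}"
  proof -
    let ?g = "\<lambda>v. indicator D v *\<^sub>R h v"
    have g[measurable]: "?g \<in> borel_measurable borel" using that by (intro borel_measurable_continuous_on_indicator) auto
    have e: "indicator D v *\<^sub>R h (T v) = ?g (T v)" for v by (simp add: indicator_def TD)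
    show "set_integrable lborel D (\<lambda>v. h (T v)) \<longleftrightarrow> set_integrable lborel D h"
      unfolding set_integrable_def e using integrable_distr_eq[of T lborel borel ?g] by (simp add: dT)
    show "(LINT v:D|lborel. h (T v)) = (LINT v:D|lborel. h v)"
      unfolding set_lebesgue_integral_def e using integral_distr[of T lborel borel ?g] by (simp add: dT)
  qed
  have berg: "(\<lambda>v. f (T v)) \<in> bergman_space D" if f: "f \<in> bergman_space D" for f
  proof -
    have hol: "holomorphic_several f D" and sq: "set_integrable lborel D (\<lambda>z. (cmod (f z))\<^sup>2)"
      using f by (auto simp: bergman_space_def)
    have "holomorphic_several (\<lambda>v. f (T v)) D"
      unfolding holomorphic_several_def
    proof
      fix z assume "z \<in> D"
      hence "T z \<in> D" by (simp add: TD)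
      then obtain f' where f': "(f has_derivative f') (at (T z))" "\<And>c v. f' (c *s v) = c * f' v"
        using hol unfolding holomorphic_several_def by meson
      from diff_chain_at[OF bounded_linear_imp_has_derivative[OF blin] f'(1)]
      show "\<exists>f'. ((\<lambda>v. f (T v)) has_derivative f') (at z) \<and> (\<forall>c v. f' (c *s v) = c * f' v)"
        by (intro exI[of _ "\<lambda>h. f' (T h)"]) (auto simp: o_def f'(2) Tscale)
    qed
    moreover have "set_integrable lborel D (\<lambda>z. (cmod (f (T z)))\<^sup>2)"
    proof -
      have "continuous_on D (\<lambda>z. (cmod (f z))\<^sup>2)"
        by (intro continuous_intros holomorphic_several_imp_continuous_on hol)
      from inv(1)[OF this] sq show ?thesis by simp
    qed
    ultimately show ?thesis by (simp add: bergman_space_def)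
  qed
  have kb: "k \<in> bergman_space D" and kr: "\<And>f. f \<in> bergman_space D \<Longrightarrow> f (T w) = (LINT z:D|lborel. f z * cnj (k z))"
    using k by (auto simp: reproduces_at_def)
  have cont: "continuous_on D f" if "f \<in> bergman_space D" for f
    using that by (auto simp: bergman_space_def intro: holomorphic_several_imp_continuous_on)
  show ?thesis unfolding reproduces_at_def
  proof (intro conjI ballI)
    show "(\<lambda>v. k (T v)) \<in> bergman_space D" by (rule berg[OF kb])
    fix f assume f: "f \<in> bergman_space D"
    have "f w = (LINT z:D|lborel. f (T z) * cnj (k z))" using kr[OF berg[OF f]] by (simp add: TT)
    also have "\<dots> = (LINT z:D|lborel. f (T (T z)) * cnj (k (T z)))"
      using inv(2)[of "\<lambda>z. f (T z) * cnj (k z)"] cont[OF berg[OF f]] cont[OF kb]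
      by (simp add: continuous_intros)
    finally show "f w = (LINT z:D|lborel. f z * cnj (k (T z)))" by (simp add: TT)
  qed
qed

section \<open>Uniqueness of the kernel, its zeros, and the theorem\<close>

text \<open>Each of the two functions is evaluated by pairing it with the other.\<close>

lemma reproduces_at_symmetric:
  assumes k: "reproduces_at D w k" and h: "reproduces_at D z h"
  shows "k z = cnj (h w)"
proof -
  have kb: "k \<in> bergman_space D" and hb: "h \<in> bergman_space D" using k h by (auto simp: reproduces_at_def)
  have "k z = (LINT v:D|lborel. k v * cnj (h v))" using h kb by (auto simp: reproduces_at_def)
  moreover have "h w = (LINT v:D|lborel. h v * cnj (k v))" using k hb by (auto simp: reproduces_at_def)
  moreover have "cnj (LINT v:D|lborel. h v * cnj (k v)) = (LINT v:D|lborel. k v * cnj (h v))"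
    unfolding set_lebesgue_integral_def
    by (subst Bochner_Integration.integral_cnj[symmetric]) (simp add: mult.commute)
  ultimately show ?thesis by simp
qed

text \<open>Once reproducing functions exist at all points of \<open>D\<close>, symmetry determines the values of any
reproducing function on \<open>D\<close>, so the choice in the definition of the kernel is harmless.\<close>

lemma bergman_kernel_eq:
  assumes ex: "\<And>w. w \<in> D \<Longrightarrow> \<exists>k. reproduces_at D w k" and k: "reproduces_at D w k" and z: "z \<in> D"
  shows "bergman_kernel D z w = k z"
proof -
  obtain h where h: "reproduces_at D z h" using ex[OF z] by blast
  have "reproduces_at D w (SOME k. reproduces_at D w k)" using someI_ex[of "reproduces_at D w"] k by blast
  from reproduces_at_symmetric[OF this h] reproduces_at_symmetric[OF k h]
  show ?thesis by (simp add: bergman_kernel_def)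
qed

text \<open>The value of \<open>kernel_quadratic \<mu> m\<close> at \<open>-1\<close>.\<close>

definition quadratic_at_minus_one :: "real \<Rightarrow> nat \<Rightarrow> real" where
  "quadratic_at_minus_one \<mu> m = 8 + 6 * (real m - 1) * \<mu> + real m * (real m - 3) * \<mu>\<^sup>2"

lemma kernel_quadratic_expand:
  "kernel_quadratic \<mu> m x = of_real ((\<mu> * m + 1) * (\<mu> * m + 2)) + of_real ((\<mu> - 1) * (4 + \<mu> * (3 * m + 1))) * x
     + of_real ((\<mu> - 1) * (\<mu> - 2)) * x\<^sup>2"
  by (simp add: kernel_quadratic_def power2_eq_square algebra_simps)

text \<open>A non-real zero has squared modulus \<open>c0 / c2\<close>, the product of the two conjugate zeros. A real zero in
\<open>(-1, 1)\<close> is excluded by \<open>\<bar>c1\<bar> \<le> c0 + c2\<close>, which gives the lower bound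
\<open>(1 - t) (c0 - c2 t)\<close> for the value at a point of modulus \<open>t\<close>.\<close>

lemma real_quadratic_nonzero_in_disc:
  fixes c0 c1 c2 :: real and x :: complex
  assumes c: "\<bar>c2\<bar> < c0" and pos: "c0 + c1 + c2 \<ge> 0" "c0 - c1 + c2 \<ge> 0" and x: "cmod x < 1"
  shows "of_real c0 + of_real c1 * x + of_real c2 * x\<^sup>2 \<noteq> 0"
proof
  assume z: "of_real c0 + of_real c1 * x + of_real c2 * x\<^sup>2 = 0"
  let ?u = "Re x" and ?v = "Im x"
  have re: "c0 + c1 * ?u + c2 * (?u\<^sup>2 - ?v\<^sup>2) = 0" and im: "?v * (c1 + 2 * c2 * ?u) = 0"
    using arg_cong[OF z, of Re] arg_cong[OF z, of Im] by (simp_all add: power2_eq_square algebra_simps)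
  have m: "(cmod x)\<^sup>2 = ?u\<^sup>2 + ?v\<^sup>2" by (rule cmod_power2)
  show False
  proof (cases "?v = 0")
    case False
    hence c1: "c1 = - 2 * c2 * ?u" using im by simp
    have "c0 = c2 * (cmod x)\<^sup>2" using re unfolding c1 m by (simp add: power2_eq_square algebra_simps)
    also have "\<dots> \<le> \<bar>c2\<bar> * 1" using x by (intro mult_mono) (auto simp: power_le_one)
    finally show False using c by simp
  next
    case True
    define t where "t = \<bar>?u\<bar>"
    have t: "0 \<le> t" "t < 1" "?u\<^sup>2 = t\<^sup>2"
      using x True by (auto simp: t_def cmod_def)
    have "\<bar>c1\<bar> \<le> c0 + c2" using pos by linarith
    hence "\<bar>c1 * ?u\<bar> \<le> (c0 + c2) * t" unfolding t_def abs_mult by (intro mult_right_mono) auto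
    hence "c0 - (c0 + c2) * t + c2 * t\<^sup>2 \<le> 0" using re True t(3) by simp
    hence "(1 - t) * (c0 - c2 * t) \<le> 0" by (simp add: power2_eq_square algebra_simps)
    moreover have "c2 * t \<le> \<bar>c2\<bar> * 1" using t by (intro mult_mono) auto
    hence "c0 - c2 * t > 0" using c by simp
    hence "(1 - t) * (c0 - c2 * t) > 0" using t by simp
    ultimately show False by simp
  qed
qed

lemma kernel_quadratic_nonzero:
  assumes \<mu>: "\<mu> > 0" and m: "m \<ge> 1" and b: "quadratic_at_minus_one \<mu> m \<ge> 0" and x: "cmod x < 1"
  shows "kernel_quadratic \<mu> m x \<noteq> 0"
  unfolding kernel_quadratic_expand
proof (rule real_quadratic_nonzero_in_disc[OF _ _ _ x])
  let ?c0 = "(\<mu> * m + 1) * (\<mu> * m + 2)" and ?c1 = "(\<mu> - 1) * (4 + \<mu> * (3 * m + 1))" and ?c2 = "(\<mu> - 1) * (\<mu> - 2)"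
  have m1: "real m \<ge> 1" using m by simp
  have "?c0 - ?c2 = ((real m)\<^sup>2 - 1) * \<mu>\<^sup>2 + 3 * (real m + 1) * \<mu>" by (simp add: power2_eq_square algebra_simps)
  moreover have "\<dots> > 0" using m1 \<mu> by (intro add_nonneg_pos mult_nonneg_nonneg mult_pos_pos) (auto simp: one_le_power)
  moreover have "?c0 + ?c2 = ((real m)\<^sup>2 + 1) * \<mu>\<^sup>2 + 3 * (real m - 1) * \<mu> + 4" by (simp add: power2_eq_square algebra_simps)
  moreover have "\<dots> > 0" using m1 \<mu> by (intro add_nonneg_pos add_nonneg_nonneg mult_nonneg_nonneg) auto
  ultimately show "\<bar>?c2\<bar> < ?c0" by linarith
  have "?c0 + ?c1 + ?c2 = \<mu>\<^sup>2 * (real m + 1) * (real m + 2)" by (simp add: power2_eq_square algebra_simps)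
  also have "\<dots> \<ge> 0" by simp
  finally show "?c0 + ?c1 + ?c2 \<ge> 0" .
  have "?c0 - ?c1 + ?c2 = quadratic_at_minus_one \<mu> m" by (simp add: quadratic_at_minus_one_def power2_eq_square algebra_simps)
  with b show "?c0 - ?c1 + ?c2 \<ge> 0" by simp
qed

lemma kernel_quadratic_negative_zero:
  assumes \<mu>: "\<mu> > 0" and b: "quadratic_at_minus_one \<mu> m < 0"
  obtains t where "0 < t" "t < 1" "kernel_quadratic \<mu> m (of_real (- t)) = 0"
proof -
  define p where "p s = (\<mu> * m + 1) * (\<mu> * m + 2) - (\<mu> - 1) * (4 + \<mu> * (3 * m + 1)) * s + (\<mu> - 1) * (\<mu> - 2) * s\<^sup>2" for s
  have p1: "p 1 = quadratic_at_minus_one \<mu> m" by (simp add: p_def quadratic_at_minus_one_def power2_eq_square algebra_simps)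
  have p0: "p 0 > 0" using \<mu> by (auto simp: p_def intro!: mult_pos_pos add_nonneg_pos)
  have "\<exists>t. 0 \<le> t \<and> t \<le> 1 \<and> p t = 0"
    by (rule IVT2') (use p0 p1 b in \<open>auto simp: p_def intro!: continuous_intros\<close>)
  then obtain t where t: "0 \<le> t" "t \<le> 1" "p t = 0" by blast
  have "t \<noteq> 0" "t \<noteq> 1" using t(3) p0 p1 b by auto
  moreover have "kernel_quadratic \<mu> m (of_real (- t)) = of_real (p t)"
    unfolding kernel_quadratic_expand p_def by simp
  ultimately show ?thesis using that[of t] t by simp
qed

text \<open>A zero \<open>-t\<close> of the quadratic in \<open>(-1, 0)\<close> is attained by \<open>\<xi>\<close> at the points \<open>(0, - sqrt t)\<close> and
\<open>(0, sqrt t)\<close> of the fibre over the centre of the base.\<close>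

lemma lu_qikeng_iff_quadratic_at_minus_one:
  assumes \<mu>: "\<mu> > 0"
  shows "lu_qikeng_domain (Omega_hat \<mu> :: (complex ^ (2 + 'm::finite)) set) \<longleftrightarrow> quadratic_at_minus_one \<mu> CARD('m) \<ge> 0"
proof -
  let ?D = "Omega_hat \<mu> :: (complex ^ (2 + 'm)) set"
  obtain j :: 'm where True by simp
  obtain C where C: "C > 0"
    "\<And>l k. axis_point j l k \<in> ?D \<Longrightarrow> reproduces_at ?D (axis_point j l k) (explicit_kernel C \<mu> j l k)"
    by (rule explicit_kernel_reproduces[OF \<mu>, of j]) blast
  have gen: "\<exists>T l k. axis_point j l k \<in> ?D \<and> (\<forall>v. T v \<in> ?D \<longleftrightarrow> v \<in> ?D)
      \<and> reproduces_at ?D w (\<lambda>v. explicit_kernel C \<mu> j l k (T v))" if w: "w \<in> ?D" for w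
  proof -
    obtain T l k where T: "unitary_involution T" "T w = axis_point j l k" "\<And>v. T v \<in> ?D \<longleftrightarrow> v \<in> ?D"
      by (rule unitary_to_axis_point[of w j \<mu>]) blast
    have ap: "axis_point j l k \<in> ?D" using T(2) T(3)[of w] w by simp
    have "reproduces_at ?D w (\<lambda>v. explicit_kernel C \<mu> j l k (T v))"
      using C(2)[OF ap] T(2) by (intro reproduces_at_unitary[OF T(1) open_Omega_hat T(3)]) simp
    with ap T(3) show ?thesis by blast
  qed
  hence ex: "\<exists>k. reproduces_at ?D w k" if "w \<in> ?D" for w using that by blast
  have kernel_zero: "explicit_kernel C \<mu> j l k v = 0 \<longleftrightarrow> kernel_quadratic \<mu> CARD('m) (kernel_variable \<mu> j l k v) = 0"
    and var: "cmod (kernel_variable \<mu> j l k v) < 1"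
    if w: "axis_point j l k \<in> ?D" and v: "v \<in> ?D" for l k v
  proof -
    obtain q where q: "q < 1" "\<And>v. v \<in> ?D \<Longrightarrow> cmod (kernel_variable \<mu> j l k v) \<le> q"
      by (rule kernel_variable_bound[OF \<mu> w]) blast
    show v1: "cmod (kernel_variable \<mu> j l k v) < 1" using q(1) q(2)[OF v] by simp
    have "1 - kernel_variable \<mu> j l k v \<noteq> 0" using v1 by auto
    moreover have "1 - v $ Inl 1 * cnj l \<noteq> 0"
      using w by (intro one_minus_mult_cnj(2) Omega_hat_component_less_1[OF \<mu> v]) (auto simp: axis_point_in_Omega_hat)
    ultimately show "explicit_kernel C \<mu> j l k v = 0 \<longleftrightarrow> kernel_quadratic \<mu> CARD('m) (kernel_variable \<mu> j l k v) = 0"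
      using C(1) unfolding explicit_kernel_def by (simp only: mult_eq_0_iff divide_eq_0_iff power_eq_0_iff powr_eq_0_iff of_real_eq_0_iff fact_nonzero) auto
  qed
  have "(\<forall>z\<in>?D. \<forall>w\<in>?D. bergman_kernel ?D z w \<noteq> 0) \<longleftrightarrow> quadratic_at_minus_one \<mu> CARD('m) \<ge> 0"
  proof (intro iffI ballI)
    fix z w assume b: "quadratic_at_minus_one \<mu> CARD('m) \<ge> 0" and z: "z \<in> ?D" and w: "w \<in> ?D"
    obtain T l k where T: "axis_point j l k \<in> ?D" "\<And>v. T v \<in> ?D \<longleftrightarrow> v \<in> ?D"
      "reproduces_at ?D w (\<lambda>v. explicit_kernel C \<mu> j l k (T v))" using gen[OF w] by blast
    have Tz: "T z \<in> ?D" using T(2) z by simp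
    have "bergman_kernel ?D z w = explicit_kernel C \<mu> j l k (T z)"
      by (rule bergman_kernel_eq[OF ex T(3) z])
    also have "\<dots> \<noteq> 0"
      unfolding kernel_zero[OF T(1) Tz]
      by (intro kernel_quadratic_nonzero \<mu> b var[OF T(1) Tz]) (simp add: Suc_le_eq)
    finally show "bergman_kernel ?D z w \<noteq> 0" .
  next
    assume nz: "\<forall>z\<in>?D. \<forall>w\<in>?D. bergman_kernel ?D z w \<noteq> 0"
    show "quadratic_at_minus_one \<mu> CARD('m) \<ge> 0"
    proof (rule ccontr)
      assume "\<not> quadratic_at_minus_one \<mu> CARD('m) \<ge> 0"
      then obtain t where t: "0 < t" "t < 1" "kernel_quadratic \<mu> CARD('m) (of_real (- t)) = 0"
        using kernel_quadratic_negative_zero[OF \<mu>, of "CARD('m)"] by (auto simp: not_le)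
      define k where "k = complex_of_real (sqrt t)"
      have w: "axis_point j 0 k \<in> ?D" and v: "axis_point j 0 (- k) \<in> ?D"
        using t by (simp_all add: axis_point_in_Omega_hat k_def)
      have "kernel_variable \<mu> j 0 k (axis_point j 0 (- k)) = of_real (- t)"
        using t by (simp add: kernel_variable_def k_def flip: of_real_mult)
      hence "explicit_kernel C \<mu> j 0 k (axis_point j 0 (- k)) = 0"
        using t(3) kernel_zero[OF w v] by simp
      with bergman_kernel_eq[OF ex C(2)[OF w] v] nz w v show False by simp
    qed
  qed
  thus ?thesis
    unfolding lu_qikeng_domain_def
    using open_Omega_hat[of \<mu>, where 'm = 'm] connected_Omega_hat[OF \<mu>, where 'm = 'm] zero_in_Omega_hat[of \<mu>, where 'a = 'm]
    by auto
qed

theorem mainTheorem3: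
  fixes \<mu> :: real
  assumes "\<mu> > 0"
  shows "(CARD('m::finite) = 1 \<longrightarrow>
            (lu_qikeng_domain (Omega_hat \<mu> :: (complex ^ (2 + 'm)) set) \<longleftrightarrow> \<mu> \<le> 2)) \<and>
         (CARD('m) = 2 \<longrightarrow>
            (lu_qikeng_domain (Omega_hat \<mu> :: (complex ^ (2 + 'm)) set) \<longleftrightarrow> \<mu> \<le> 4)) \<and>
         (CARD('m) \<ge> 3 \<longrightarrow>
            lu_qikeng_domain (Omega_hat \<mu> :: (complex ^ (2 + 'm)) set))"
proof (intro conjI impI)
  assume m: "CARD('m) = 1"
  have "quadratic_at_minus_one \<mu> 1 = 2 * (2 - \<mu>) * (2 + \<mu>)"
    by (simp add: quadratic_at_minus_one_def power2_eq_square algebra_simps)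
  thus "lu_qikeng_domain (Omega_hat \<mu> :: (complex ^ (2 + 'm)) set) \<longleftrightarrow> \<mu> \<le> 2"
    using assms unfolding lu_qikeng_iff_quadratic_at_minus_one[OF assms] m by (simp add: zero_le_mult_iff)
next
  assume m: "CARD('m) = 2"
  have "quadratic_at_minus_one \<mu> 2 = 2 * (4 - \<mu>) * (1 + \<mu>)"
    by (simp add: quadratic_at_minus_one_def power2_eq_square algebra_simps)
  thus "lu_qikeng_domain (Omega_hat \<mu> :: (complex ^ (2 + 'm)) set) \<longleftrightarrow> \<mu> \<le> 4"
    using assms unfolding lu_qikeng_iff_quadratic_at_minus_one[OF assms] m by (simp add: zero_le_mult_iff)
next
  assume "CARD('m) \<ge> 3"
  hence m: "real CARD('m) \<ge> 3" by simp
  have "quadratic_at_minus_one \<mu> CARD('m) \<ge> 0"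
    unfolding quadratic_at_minus_one_def using m assms by (intro add_nonneg_nonneg mult_nonneg_nonneg) auto
  thus "lu_qikeng_domain (Omega_hat \<mu> :: (complex ^ (2 + 'm)) set)"
    by (simp add: lu_qikeng_iff_quadratic_at_minus_one[OF assms])
qed

end
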